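(* Let $G$ be a random graph drawn from $G(n,p)$ with $p=n^{-1/3}$, let $\mathcal{C}$ be the set of 4-cliques of $G$ (as 4-element vertex sets), and let $f(x)=\sum_{\{i_1,i_2,i_3,i_4\}\in\mathcal{C}}x_{i_1}x_{i_2}x_{i_3}x_{i_4}$. Then for any $q$ divisible by $4$, with high probability over $G$, \[\frac{\|f^{q/4}\|_{sp}}{\|f^{q/4}\|_2}\ \ge\ \frac{n^{q/24}}{(q\log n)^{O(q)}}.\]
   Context: $\|h\|_2:=\sup_{\|x\|_2=1}|h(x)|$. For a homogeneous polynomial $h$ of even degree $t$, $\|h\|_{sp}:=\inf\{\|M\|_2:\ M\in\mathbb{R}^{[n]^{t/2}\times[n]^{t/2}}\text{ symmetric},\ (x^{\otimes t/2})^TMx^{\otimes t/2}=h(x)\ \forall x\in\mathbb{R}^n\}$, where $\|M\|_2$ is the spectral (operator) norm. *)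

theory Defs
  imports "HOL-Probability.Probability" "HOL-Library.Ramsey"
begin

text \<open>
  A vector of \<open>\<real>\<^sup>n\<close> is a function \<open>x :: nat \<Rightarrow> real\<close> of which only the values on the
  index set \<open>{..<n}\<close> are used, so its Euclidean norm is \<open>L2_set x {..<n}\<close>. A polynomial is
  identified with the real function it induces.
\<close>

definition two_norm :: "nat \<Rightarrow> ((nat \<Rightarrow> real) \<Rightarrow> real) \<Rightarrow> real" where
  "two_norm n h = (SUP x \<in> {x. L2_set x {..<n} = 1}. \<bar>h x\<bar>)"

definition tuples :: "nat \<Rightarrow> nat \<Rightarrow> nat list set" where
  "tuples n k = {I. set I \<subseteq> {..<n} \<and> length I = k}"

definition tensor_power :: "(nat \<Rightarrow> real) \<Rightarrow> nat list \<Rightarrow> real" where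
  "tensor_power x I = (\<Prod>i\<leftarrow>I. x i)"

definition symmetric_matrix :: "'i set \<Rightarrow> ('i \<Rightarrow> 'i \<Rightarrow> real) \<Rightarrow> bool" where
  "symmetric_matrix A M \<longleftrightarrow> (\<forall>I\<in>A. \<forall>J\<in>A. M I J = M J I)"

definition spectral_norm :: "'i set \<Rightarrow> ('i \<Rightarrow> 'i \<Rightarrow> real) \<Rightarrow> real" where
  "spectral_norm A M = (SUP u \<in> {u. L2_set u A = 1}. L2_set (\<lambda>I. \<Sum>J\<in>A. M I J * u J) A)"

text \<open>
  The degree \<open>t\<close> is an argument because it determines the size of the representing matrices;
  it is meant to be even and \<open>h\<close> to be homogeneous of degree \<open>t\<close>.
\<close>

definition represents :: "nat \<Rightarrow> nat \<Rightarrow> (nat list \<Rightarrow> nat list \<Rightarrow> real) \<Rightarrow> ((nat \<Rightarrow> real) \<Rightarrow> real) \<Rightarrow> bool"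
  where
  "represents n t M h \<longleftrightarrow>
     (\<forall>x. (\<Sum>I\<in>tuples n (t div 2). \<Sum>J\<in>tuples n (t div 2).
             tensor_power x I * M I J * tensor_power x J) = h x)"

definition sp_norm :: "nat \<Rightarrow> nat \<Rightarrow> ((nat \<Rightarrow> real) \<Rightarrow> real) \<Rightarrow> real" where
  "sp_norm n t h =
     Inf {spectral_norm (tuples n (t div 2)) M | M.
            symmetric_matrix (tuples n (t div 2)) M \<and> represents n t M h}"

text \<open>
  A graph on the vertex set \<open>{..<n}\<close> is given by its edge set, a set of two-element vertex sets.
\<close>

definition gnp :: "nat \<Rightarrow> real \<Rightarrow> nat set set pmf" where
  "gnp n p =
     map_pmf (\<lambda>b. {e \<in> nsets {..<n} 2. b e})
       (Pi_pmf (nsets {..<n} 2) False (\<lambda>_. bernoulli_pmf p))"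

definition four_cliques :: "nat \<Rightarrow> nat set set \<Rightarrow> nat set set" where
  "four_cliques n E = {K \<in> nsets {..<n} 4. nsets K 2 \<subseteq> E}"

definition clique_poly :: "nat \<Rightarrow> nat set set \<Rightarrow> (nat \<Rightarrow> real) \<Rightarrow> real" where
  "clique_poly n E x = (\<Sum>K\<in>four_cliques n E. \<Prod>i\<in>K. x i)"

end

theory Submission
  imports Defs "HOL-Combinatorics.Multiset_Permutations" "HOL-Computational_Algebra.Polynomial"
    "HOL-Real_Asymp.Real_Asymp"
begin

text \<open>
  Write \<open>m = q / 4\<close>, \<open>r = n\<^sup>1\<^sup>/\<^sup>3\<close>, so that \<open>p = 1 / r\<close>, and let \<open>L = (ln n)\<^sup>2\<close> absorb logarithms.

  The spectral norm of a matrix \<open>M\<close> representing \<open>f\<^sup>m\<close> is bounded from below by pairing \<open>M\<close> with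
  the matrix \<open>Z I J = c (I @ J)\<close>, where \<open>c \<alpha>\<close> is the coefficient of \<open>x\<^sup>\<alpha>\<close> in \<open>f\<^sup>m\<close>: the pairing is
  \<open>\<Sum>\<alpha>. (c \<alpha>)\<^sup>2\<close>, which is at least \<open>f(1, \<dots>, 1)\<^sup>m\<close>, the \<open>m\<close>-th power of the number of cliques (about
  \<open>r\<^sup>6\<close>), whereas \<open>Z\<close> has only about \<open>r\<^sup>5\<^sup>m\<close> nonzero columns, the typical one indexing \<open>m\<close> edges.
  This gives \<open>r\<^sup>m\<^sup>/\<^sup>2 = n\<^sup>q\<^sup>/\<^sup>2\<^sup>4\<close>.

  For \<open>\<parallel>f\<parallel>\<^sub>2\<close>, order each clique by decreasing coordinates. A triangle lies in at most \<open>L\<close> cliques, so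
  the smallest coordinate can be replaced by the third one at the cost of a factor \<open>L\<close>. Splitting the
  coordinates into dyadic levels leaves triangle counts between three vertex sets, which follow from
  bounds on edge counts and codegrees. With high probability all of these are within logarithmic
  factors of their means.
\<close>

subsection \<open>Representing matrices and coefficients\<close>

lemma digit_sum_less:
  fixes a :: "nat \<Rightarrow> nat"
  assumes "\<And>i. a i < B"
  shows "(\<Sum>i<n. a i * B ^ i) < B ^ n"
proof (induction n)
  case (Suc n)
  have "(\<Sum>i<Suc n. a i * B ^ i) < B ^ n + a n * B ^ n"
    using Suc by simp
  also have "\<dots> = Suc (a n) * B ^ n" by simp
  also have "\<dots> \<le> B * B ^ n"
    using assms[of n] by (intro mult_right_mono) auto
  finally show ?case by simp
qed simp

lemma digits_unique:
  fixes a b :: "nat \<Rightarrow> nat"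
  assumes "\<And>i. a i < B" "\<And>i. b i < B"
    and "(\<Sum>i<n. a i * B ^ i) = (\<Sum>i<n. b i * B ^ i)" "i < n"
  shows "a i = b i"
  using assms(3,4)
proof (induction n)
  case (Suc n)
  have less: "(\<Sum>i<n. a i * B ^ i) < B ^ n" "(\<Sum>i<n. b i * B ^ i) < B ^ n"
    using assms(1,2) by (auto intro: digit_sum_less)
  have "B ^ n \<noteq> 0" using less by linarith
  then have "(\<Sum>i<Suc n. a i * B ^ i) div B ^ n = a n" "(\<Sum>i<Suc n. b i * B ^ i) div B ^ n = b n"
    using less by (auto simp: div_mult_self3)
  then have "a n = b n" using Suc.prems(1) by simp
  moreover from this have "(\<Sum>i<n. a i * B ^ i) = (\<Sum>i<n. b i * B ^ i)"
    using Suc.prems(1) by simp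
  ultimately show ?case using Suc by (cases "i = n") auto
qed simp

text \<open>Every multiplicity is at most the size, hence below \<open>B\<close>, so the
  multiplicities are the base-\<open>B\<close> digits of the weight, and digits are unique.\<close>

lemma multiset_weight_inject:
  fixes \<alpha> \<beta> :: "nat multiset"
  assumes "size \<alpha> < B" "size \<beta> < B" "(\<Sum>i\<in>#\<alpha>. B ^ i) = (\<Sum>i\<in>#\<beta>. B ^ i)"
  shows "\<alpha> = \<beta>"
proof -
  obtain n where n: "set_mset \<alpha> \<union> set_mset \<beta> \<subseteq> {..<n}"
    using finite_nat_bounded[of "set_mset \<alpha> \<union> set_mset \<beta>"] by auto
  have sum: "(\<Sum>i\<in>#\<gamma>. B ^ i) = (\<Sum>i<n. count \<gamma> i * B ^ i)" if "set_mset \<gamma> \<subseteq> {..<n}" for \<gamma>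
    using that
  proof (induction \<gamma>)
    case (add a \<gamma>)
    have "(\<Sum>i<n. count (add_mset a \<gamma>) i * B ^ i) = (\<Sum>i<n. count \<gamma> i * B ^ i + (if i = a then B ^ i else 0))"
      by (intro sum.cong) (auto simp: algebra_simps)
    also have "\<dots> = (\<Sum>i<n. count \<gamma> i * B ^ i) + B ^ a"
      using add.prems by (simp add: sum.distrib)
    finally show ?case using add by simp
  qed simp
  have "count \<alpha> i = count \<beta> i" for i
  proof (cases "i < n")
    case True
    then show ?thesis
      using assms n sum[of \<alpha>] sum[of \<beta>] digits_unique[of "count \<alpha>" B "count \<beta>" n i]
      by (metis Un_subset_iff count_le_size le_less_trans)
  next
    case False
    then show ?thesis using n by (metis Un_subset_iff lessThan_iff not_in_iff subsetD)
  qed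
  then show ?thesis by (rule multiset_eqI)
qed

lemma prod_mset_power_eq:
  "(\<Prod>i\<in>#\<alpha>. (z::real) ^ w i) = z ^ (\<Sum>i\<in>#\<alpha>. w i)"
  by (induction \<alpha>) (auto simp: power_add)

text \<open>Kronecker substitution \<open>x\<^sub>i = z ^ (B ^ i)\<close> reduces the claim to univariate polynomials.\<close>

lemma monomial_coeffs_unique:
  fixes a :: "'s \<Rightarrow> real" and b :: "'t \<Rightarrow> real" and \<mu> :: "'s \<Rightarrow> nat multiset"
  assumes fin: "finite S" "finite T"
    and eq: "\<And>x. (\<Sum>s\<in>S. a s * (\<Prod>i\<in>#\<mu> s. x i)) = (\<Sum>t\<in>T. b t * (\<Prod>i\<in>#\<nu> t. x i))"
  shows "(\<Sum>s | s \<in> S \<and> \<mu> s = \<alpha>. a s) = (\<Sum>t | t \<in> T \<and> \<nu> t = \<alpha>. b t)"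
proof -
  have "finite (insert (size \<alpha>) ((size \<circ> \<mu>) ` S \<union> (size \<circ> \<nu>) ` T))"
    using fin by auto
  \<comment> \<open>\<open>B\<close> exceeds the degree of every monomial on both sides and of
    \<open>\<alpha>\<close>, so the substitution sends no other monomial to the power of
    \<open>z\<close> that belongs to \<open>\<alpha>\<close>.\<close>
  then obtain B where B: "insert (size \<alpha>) ((size \<circ> \<mu>) ` S \<union> (size \<circ> \<nu>) ` T) \<subseteq> {..<B}"
    using finite_nat_bounded by blast
  define w where "w \<gamma> = (\<Sum>i\<in>#\<gamma>. B ^ i)" for \<gamma> :: "nat multiset"
  have w: "w \<gamma> = w \<alpha> \<longleftrightarrow> \<gamma> = \<alpha>" if "size \<gamma> < B" for \<gamma>
    using multiset_weight_inject[of \<gamma> B \<alpha>] that B unfolding w_def by auto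
  have "poly (\<Sum>s\<in>S. monom (a s) (w (\<mu> s))) z = poly (\<Sum>t\<in>T. monom (b t) (w (\<nu> t))) z" for z
    using eq[of "\<lambda>i. z ^ (B ^ i)"]
    by (simp add: poly_sum poly_monom prod_mset_power_eq w_def)
  then have "(\<Sum>s\<in>S. monom (a s) (w (\<mu> s))) = (\<Sum>t\<in>T. monom (b t) (w (\<nu> t)))"
    using poly_eq_poly_eq_iff by blast
  then have "coeff (\<Sum>s\<in>S. monom (a s) (w (\<mu> s))) (w \<alpha>) = coeff (\<Sum>t\<in>T. monom (b t) (w (\<nu> t))) (w \<alpha>)"
    by simp
  then have "(\<Sum>s\<in>S. if w (\<mu> s) = w \<alpha> then a s else 0) = (\<Sum>t\<in>T. if w (\<nu> t) = w \<alpha> then b t else 0)"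
    by (simp add: coeff_sum)
  also have "(\<Sum>s\<in>S. if w (\<mu> s) = w \<alpha> then a s else 0) = (\<Sum>s\<in>S. if \<mu> s = \<alpha> then a s else 0)"
    by (intro sum.cong) (use B w in auto)
  also have "(\<Sum>t\<in>T. if w (\<nu> t) = w \<alpha> then b t else 0) = (\<Sum>t\<in>T. if \<nu> t = \<alpha> then b t else 0)"
    by (intro sum.cong) (use B w in auto)
  finally show ?thesis
    using fin by (simp add: sum.inter_filter)
qed

section \<open>Lower bound on the spectral norm of a representing matrix\<close>

lemma finite_tuples: "finite (tuples n k)"
  unfolding tuples_def by (rule finite_lists_length_eq) simp

lemma tensor_power_mset: "tensor_power x I = (\<Prod>i\<in>#mset I. x i)"
  by (simp add: tensor_power_def flip: prod_mset_prod_list)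

text \<open>Column \<open>J\<close> is the image of the coordinate unit vector at \<open>J\<close>,
  which competes in the supremum.\<close>

lemma L2_set_column_le_spectral_norm:
  assumes "finite A" "J \<in> A"
  shows "L2_set (\<lambda>I. M I J) A \<le> spectral_norm A M"
proof -
  \<comment> \<open>A real supremum dominates its members only if they are bounded. Cauchy-Schwarz
    in each row gives the Frobenius norm of \<open>M\<close> as a bound.\<close>
  have bdd: "bdd_above ((\<lambda>u. L2_set (\<lambda>I. \<Sum>J\<in>A. M I J * u J) A) ` {u. L2_set u A = 1})"
  proof (rule bdd_aboveI2)
    fix u :: "'a \<Rightarrow> real" assume u: "u \<in> {u. L2_set u A = 1}"
    have "\<bar>\<Sum>J\<in>A. M I J * u J\<bar> \<le> L2_set (M I) A" for I
    proof -
      have "\<bar>\<Sum>J\<in>A. M I J * u J\<bar> \<le> (\<Sum>J\<in>A. \<bar>M I J\<bar> * \<bar>u J\<bar>)"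
        by (rule order_trans[OF sum_abs]) (simp add: abs_mult)
      also have "\<dots> \<le> L2_set (M I) A * L2_set u A" by (rule L2_set_mult_ineq)
      finally show ?thesis using u by simp
    qed
    then have "L2_set (\<lambda>I. \<bar>\<Sum>J\<in>A. M I J * u J\<bar>) A \<le> L2_set (\<lambda>I. L2_set (M I) A) A"
      by (intro L2_set_mono) auto
    then show "L2_set (\<lambda>I. \<Sum>J\<in>A. M I J * u J) A \<le> L2_set (\<lambda>I. L2_set (M I) A) A"
      by (simp add: L2_set_def)
  qed
  define u where "u = (\<lambda>I. if I = J then 1 else 0 :: real)"
  have "(u I)\<^sup>2 = u I" for I unfolding u_def by simp
  then have "(\<Sum>I\<in>A. (u I)\<^sup>2) = 1"
    using assms unfolding u_def by simp
  then have "L2_set u A = 1" by (simp add: L2_set_def)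
  moreover have "(\<Sum>J\<in>A. M I J * u J) = M I J" for I
    using assms unfolding u_def by (simp add: if_distrib cong: if_cong)
  ultimately show ?thesis
    using cSUP_upper[OF _ bdd, of u] unfolding spectral_norm_def by simp
qed

lemma spectral_norm_nonneg:
  assumes "finite A" "A \<noteq> {}"
  shows "0 \<le> spectral_norm A M"
  using assms L2_set_column_le_spectral_norm[of A _ M] L2_set_nonneg
  by (meson all_not_in_conv order_trans)

text \<open>Concatenation is injective on pairs of lists of length \<open>k\<close>, and its values
  here are permutations of \<open>\<alpha>\<close>. This limits how often one coefficient is
  repeated in the matrix \<open>Z\<close> below.\<close>

lemma card_mset_append_eq_le:
  "card {p \<in> tuples n k \<times> tuples n k. mset (fst p @ snd p) = \<alpha>} \<le> fact (2 * k)"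
proof (cases "size \<alpha> = 2 * k")
  case True
  have "inj_on (\<lambda>(I, J). I @ J) {p \<in> tuples n k \<times> tuples n k. mset (fst p @ snd p) = \<alpha>}"
    by (auto simp: inj_on_def tuples_def)
  moreover have "(\<lambda>(I, J). I @ J) ` {p \<in> tuples n k \<times> tuples n k. mset (fst p @ snd p) = \<alpha>}
      \<subseteq> permutations_of_multiset \<alpha>"
    by (auto simp: permutations_of_multiset_def)
  ultimately have "card {p \<in> tuples n k \<times> tuples n k. mset (fst p @ snd p) = \<alpha>}
      \<le> card (permutations_of_multiset \<alpha>)"
    by (intro card_inj_on_le) auto
  also have "\<dots> \<le> fact (2 * k)"
    by (simp add: card_permutations_of_multiset True)
  finally show ?thesis .
next
  case False
  have "{p \<in> tuples n k \<times> tuples n k. mset (fst p @ snd p) = \<alpha>} = {}"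
    using False by (auto simp: tuples_def)
  then show ?thesis by (metis card.empty zero_le)
qed

text \<open>
  With \<open>c \<alpha>\<close> the coefficient of \<open>x\<^sup>\<alpha>\<close> in \<open>h\<close>, the matrix \<open>Z I J = c (I @ J)\<close> satisfies
  \<open>\<langle>M, Z\<rangle> = (\<Sum>\<alpha>. (c \<alpha>)\<^sup>2)\<close> for every representing \<open>M\<close>. Only the columns in \<open>R\<close> of \<open>Z\<close> are
  nonzero, and each column of \<open>M\<close> has Euclidean norm at most the spectral norm of \<open>M\<close>.
\<close>

lemma card_le_spectral_norm:
  fixes \<nu> :: "'t \<Rightarrow> nat multiset"
  assumes fin: "finite T" and n: "n > 0"
    and rep: "represents n (2 * k) M (\<lambda>x. \<Sum>t\<in>T. \<Prod>i\<in>#\<nu> t. x i)"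
    and R: "finite R" "\<And>I J t. \<lbrakk>I \<in> tuples n k; J \<in> tuples n k; t \<in> T; mset (I @ J) = \<nu> t\<rbrakk> \<Longrightarrow> J \<in> R"
  shows "real (card T) \<le> (spectral_norm (tuples n k) M)\<^sup>2 * (real (card R) * fact (2 * k))"
proof -
  let ?A = "tuples n k"
  define s where "s = spectral_norm ?A M"
  define c where "c \<alpha> = real (card {t \<in> T. \<nu> t = \<alpha>})" for \<alpha>
  define Z where "Z I J = c (mset (I @ J))" for I J
  define S where "S = (\<Sum>\<alpha>\<in>\<nu> ` T. (c \<alpha>)\<^sup>2)"
  define D where "D \<alpha> = {p \<in> ?A \<times> ?A. mset (fst p @ snd p) = \<alpha>}" for \<alpha>
  have finA: "finite ?A" by (rule finite_tuples)
  have "replicate k 0 \<in> ?A" using n by (auto simp: tuples_def)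
  then have s0: "s \<ge> 0" unfolding s_def by (intro spectral_norm_nonneg finA) auto
  have T_le: "real (card T) \<le> S"
  proof -
    have "real (card T) = (\<Sum>\<alpha>\<in>\<nu> ` T. c \<alpha>)"
      using fin unfolding c_def card_eq_sum by (subst sum.image_gen[OF fin, of _ \<nu>]) simp
    \<comment> \<open>On the image of \<open>\<nu>\<close> the coefficients are positive integers,
      so squaring does not decrease them.\<close>
    also have "\<dots> \<le> S" unfolding S_def
    proof (rule sum_mono)
      fix \<alpha> assume "\<alpha> \<in> \<nu> ` T"
      then have "card {t \<in> T. \<nu> t = \<alpha>} > 0" using fin by (auto simp: card_gt_0_iff)
      then have "c \<alpha> \<ge> 1" unfolding c_def by simp
      then show "c \<alpha> \<le> (c \<alpha>)\<^sup>2" by (simp add: power2_eq_square)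
    qed
    finally show ?thesis .
  qed
  have c_nonzero: "\<alpha> \<in> \<nu> ` T" if "c \<alpha> \<noteq> 0" for \<alpha>
    using that unfolding c_def by (auto simp: card_eq_0_iff)
  have coeff: "(\<Sum>p\<in>D \<alpha>. M (fst p) (snd p)) = c \<alpha>" for \<alpha>
  proof -
    have "(\<Sum>p | p \<in> ?A \<times> ?A \<and> mset (fst p @ snd p) = \<alpha>. M (fst p) (snd p))
        = (\<Sum>t | t \<in> T \<and> \<nu> t = \<alpha>. 1)"
    proof (rule monomial_coeffs_unique)
      fix x :: "nat \<Rightarrow> real"
      have "(\<Sum>p\<in>?A \<times> ?A. M (fst p) (snd p) * (\<Prod>i\<in>#mset (fst p @ snd p). x i))
          = (\<Sum>I\<in>?A. \<Sum>J\<in>?A. tensor_power x I * M I J * tensor_power x J)"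
        by (simp add: sum.cartesian_product tensor_power_mset split_beta algebra_simps)
      also have "\<dots> = (\<Sum>t\<in>T. 1 * (\<Prod>i\<in>#\<nu> t. x i))"
        using rep unfolding represents_def by simp
      finally show "(\<Sum>p\<in>?A \<times> ?A. M (fst p) (snd p) * (\<Prod>i\<in>#mset (fst p @ snd p). x i))
          = (\<Sum>t\<in>T. 1 * (\<Prod>i\<in>#\<nu> t. x i))" .
    qed (use finA fin in auto)
    then show ?thesis unfolding c_def D_def by simp
  qed
  \<comment> \<open>Regroups a sum over index pairs by the monomial to which a pair merges. It
    serves twice: with \<open>g = M\<close> for the pairing of \<open>M\<close> with
    \<open>Z\<close>, and with \<open>g = 1\<close> for the Frobenius norm of
    \<open>Z\<close>.\<close>
  have group: "(\<Sum>(I, J)\<in>?A \<times> ?A. g I J * G (mset (I @ J)))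
      = (\<Sum>\<alpha>\<in>\<nu> ` T. (\<Sum>p\<in>D \<alpha>. g (fst p) (snd p)) * G \<alpha>)"
    if G: "\<And>\<alpha>. G \<alpha> \<noteq> 0 \<Longrightarrow> \<alpha> \<in> \<nu> ` T" for g :: "nat list \<Rightarrow> nat list \<Rightarrow> real" and G :: "nat multiset \<Rightarrow> real"
  proof -
    let ?P = "{p \<in> ?A \<times> ?A. mset (fst p @ snd p) \<in> \<nu> ` T}"
    have "(\<Sum>(I, J)\<in>?A \<times> ?A. g I J * G (mset (I @ J)))
        = (\<Sum>p\<in>?P. g (fst p) (snd p) * G (mset (fst p @ snd p)))"
      by (intro sum.mono_neutral_cong_right) (use finA in \<open>auto dest: G\<close>)
    also have "\<dots> = (\<Sum>\<alpha>\<in>\<nu> ` T. \<Sum>p | p \<in> ?P \<and> mset (fst p @ snd p) = \<alpha>. g (fst p) (snd p) * G (mset (fst p @ snd p)))"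
      by (intro sum.group[symmetric]) (use finA fin in auto)
    also have "\<dots> = (\<Sum>\<alpha>\<in>\<nu> ` T. (\<Sum>p\<in>D \<alpha>. g (fst p) (snd p)) * G \<alpha>)"
      unfolding sum_distrib_right D_def by (intro sum.cong) auto
    finally show ?thesis .
  qed
  have MZ: "(\<Sum>(I, J)\<in>?A \<times> ?A. M I J * Z I J) = S"
    using group[of c M, OF c_nonzero] unfolding Z_def coeff S_def by (simp add: power2_eq_square)
  have ZZ: "(\<Sum>(I, J)\<in>?A \<times> ?A. (Z I J)\<^sup>2) \<le> fact (2 * k) * S"
  proof -
    have *: "(\<Sum>(I, J)\<in>?A \<times> ?A. (Z I J)\<^sup>2) = (\<Sum>\<alpha>\<in>\<nu> ` T. (\<Sum>p\<in>D \<alpha>. 1) * (c \<alpha>)\<^sup>2)"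
    proof -
      have "\<alpha> \<in> \<nu> ` T" if "(c \<alpha>)\<^sup>2 \<noteq> 0" for \<alpha>
        using that by (intro c_nonzero) (auto simp: power2_eq_square)
      from group[of "\<lambda>\<alpha>. (c \<alpha>)\<^sup>2" "\<lambda>_ _. 1", OF this] show ?thesis
        unfolding Z_def mult_1 .
    qed
    show ?thesis unfolding * S_def sum_distrib_left
    proof (intro sum_mono mult_right_mono)
      fix \<alpha>
      have "real (card (D \<alpha>)) \<le> real (fact (2 * k))"
        using card_mset_append_eq_le[of n k \<alpha>] unfolding D_def of_nat_le_iff .
      then show "(\<Sum>p\<in>D \<alpha>. 1) \<le> (fact (2 * k) :: real)"
        by simp
    qed auto
  qed
  have Z0: "Z I J = 0" if "I \<in> ?A" "J \<in> ?A - R" for I J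
    using that R(2)[of I J] c_nonzero[of "mset (I @ J)"] unfolding Z_def by blast
  have "S = (\<Sum>J\<in>?A. \<Sum>I\<in>?A. M I J * Z I J)"
    using MZ by (subst sum.swap) (simp add: sum.cartesian_product)
  also have "\<dots> = (\<Sum>J\<in>?A \<inter> R. \<Sum>I\<in>?A. M I J * Z I J)"
    by (intro sum.mono_neutral_right) (use finA Z0 in auto)
  \<comment> \<open>Cauchy-Schwarz inside each column, where the column of \<open>M\<close> costs a
    factor \<open>s\<close>. A second application, across the columns in \<open>R\<close>, brings in
    \<open>card R\<close>.\<close>
  also have "\<dots> \<le> (\<Sum>J\<in>?A \<inter> R. s * L2_set (\<lambda>I. Z I J) ?A)"
  proof (rule sum_mono)
    fix J assume "J \<in> ?A \<inter> R"
    have "(\<Sum>I\<in>?A. M I J * Z I J) \<le> (\<Sum>I\<in>?A. \<bar>M I J\<bar> * \<bar>Z I J\<bar>)"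
      by (intro sum_mono) (metis abs_ge_self abs_mult)
    also have "\<dots> \<le> L2_set (\<lambda>I. M I J) ?A * L2_set (\<lambda>I. Z I J) ?A" by (rule L2_set_mult_ineq)
    also have "\<dots> \<le> s * L2_set (\<lambda>I. Z I J) ?A" unfolding s_def
      by (intro mult_right_mono L2_set_column_le_spectral_norm finA) (use \<open>J \<in> ?A \<inter> R\<close> in auto)
    finally show "(\<Sum>I\<in>?A. M I J * Z I J) \<le> s * L2_set (\<lambda>I. Z I J) ?A" .
  qed
  also have "\<dots> = s * (\<Sum>J\<in>?A \<inter> R. \<bar>1\<bar> * \<bar>L2_set (\<lambda>I. Z I J) ?A\<bar>)" by (simp add: sum_distrib_left)
  also have "\<dots> \<le> s * (L2_set (\<lambda>J. 1) (?A \<inter> R) * L2_set (\<lambda>J. L2_set (\<lambda>I. Z I J) ?A) (?A \<inter> R))"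
    by (intro mult_left_mono L2_set_mult_ineq s0)
  finally have "S \<le> s * (L2_set (\<lambda>J. 1) (?A \<inter> R) * L2_set (\<lambda>J. L2_set (\<lambda>I. Z I J) ?A) (?A \<inter> R))" .
  then have "S\<^sup>2 \<le> (s * (L2_set (\<lambda>J. 1) (?A \<inter> R) * L2_set (\<lambda>J. L2_set (\<lambda>I. Z I J) ?A) (?A \<inter> R)))\<^sup>2"
    by (rule power_mono) (simp add: S_def sum_nonneg)
  also have "\<dots> = s\<^sup>2 * (card (?A \<inter> R) * (\<Sum>J\<in>?A \<inter> R. \<Sum>I\<in>?A. (Z I J)\<^sup>2))"
    by (simp add: power_mult_distrib L2_set_def sum_nonneg)
  also have "\<dots> \<le> s\<^sup>2 * (real (card R) * (fact (2 * k) * S))"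
  proof (intro mult_left_mono mult_mono)
    show "real (card (?A \<inter> R)) \<le> real (card R)" using R(1) by (simp add: card_mono)
    have "(\<Sum>J\<in>?A \<inter> R. \<Sum>I\<in>?A. (Z I J)\<^sup>2) \<le> (\<Sum>J\<in>?A. \<Sum>I\<in>?A. (Z I J)\<^sup>2)"
      by (intro sum_mono2) (auto intro: sum_nonneg finA)
    also have "\<dots> \<le> fact (2 * k) * S"
      using ZZ by (subst sum.swap) (simp add: sum.cartesian_product)
    finally show "(\<Sum>J\<in>?A \<inter> R. \<Sum>I\<in>?A. (Z I J)\<^sup>2) \<le> fact (2 * k) * S" .
  qed (auto intro!: sum_nonneg)
  finally have *: "S\<^sup>2 \<le> (s\<^sup>2 * (real (card R) * fact (2 * k))) * S" by (simp add: algebra_simps)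
  \<comment> \<open>One factor \<open>S\<close> cancels if it is positive; otherwise the right-hand
    side is nonnegative anyway.\<close>
  have "S \<le> s\<^sup>2 * (real (card R) * fact (2 * k))"
  proof (cases "S > 0")
    case True
    then show ?thesis using * by (simp add: power2_eq_square)
  next
    case False
    moreover have "0 \<le> s\<^sup>2 * (real (card R) * fact (2 * k))" by simp
    ultimately show ?thesis by linarith
  qed
  then show ?thesis using T_le unfolding s_def by linarith
qed

text \<open>The infimum in \<open>sp_norm\<close> is informative only over a nonempty set, so a
  matrix must be exhibited. Each monomial is written as a list and cut in half into a row and a
  column index; the resulting matrix is averaged with its transpose.\<close>

lemma symmetric_representation_exists:
  fixes \<nu> :: "'t \<Rightarrow> nat multiset"
  assumes fin: "finite T" and \<nu>: "\<And>t. t \<in> T \<Longrightarrow> size (\<nu> t) = 2 * k \<and> set_mset (\<nu> t) \<subseteq> {..<n}"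
  shows "\<exists>M. symmetric_matrix (tuples n k) M \<and> represents n (2 * k) M (\<lambda>x. \<Sum>t\<in>T. \<Prod>i\<in>#\<nu> t. x i)"
proof -
  let ?A = "tuples n k"
  have "\<exists>l. mset l = \<nu> t" for t by (rule ex_mset)
  then obtain l where l: "\<And>t. mset (l t) = \<nu> t" by metis
  define N where "N I J = (\<Sum>t\<in>T. if I = take k (l t) \<and> J = drop k (l t) then 1 else 0 :: real)" for I J
  define M where "M I J = (N I J + N J I) / 2" for I J
  have tup: "take k (l t) \<in> ?A" "drop k (l t) \<in> ?A" if "t \<in> T" for t
  proof -
    have "length (l t) = 2 * k" "set (l t) \<subseteq> {..<n}"
      using \<nu>[OF that] l[of t] by (metis size_mset, metis set_mset_mset)
    then show "take k (l t) \<in> ?A" "drop k (l t) \<in> ?A"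
      unfolding tuples_def by (auto dest: in_set_takeD in_set_dropD)
  qed
  have N: "(\<Sum>I\<in>?A. \<Sum>J\<in>?A. tensor_power x I * N I J * tensor_power x J) = (\<Sum>t\<in>T. \<Prod>i\<in>#\<nu> t. x i)" for x
  proof -
    have "(\<Sum>I\<in>?A. \<Sum>J\<in>?A. tensor_power x I * N I J * tensor_power x J) =
      (\<Sum>t\<in>T. \<Sum>I\<in>?A. \<Sum>J\<in>?A. if J = drop k (l t) then (if I = take k (l t) then tensor_power x I * tensor_power x J else 0) else 0)"
    proof -
      have "(\<Sum>J\<in>?A. tensor_power x I * N I J * tensor_power x J) =
        (\<Sum>t\<in>T. \<Sum>J\<in>?A. if J = drop k (l t) then (if I = take k (l t) then tensor_power x I * tensor_power x J else 0) else 0)" for I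
        unfolding N_def sum_distrib_left sum_distrib_right
        by (subst sum.swap) (intro sum.cong, auto)
      then show ?thesis by (simp only:) (rule sum.swap)
    qed
    also have "\<dots> = (\<Sum>t\<in>T. tensor_power x (take k (l t)) * tensor_power x (drop k (l t)))"
      by (intro sum.cong) (simp_all add: finite_tuples tup)
    also have "\<dots> = (\<Sum>t\<in>T. \<Prod>i\<in>#\<nu> t. x i)"
      by (intro sum.cong) (simp_all add: tensor_power_mset l[symmetric]
        flip: prod_mset.union image_mset_union mset_append)
    finally show ?thesis .
  qed
  have N': "(\<Sum>I\<in>?A. \<Sum>J\<in>?A. tensor_power x I * N J I * tensor_power x J) = (\<Sum>t\<in>T. \<Prod>i\<in>#\<nu> t. x i)" for x
    unfolding N[symmetric] by (subst sum.swap) (simp add: algebra_simps)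
  have "(\<Sum>I\<in>?A. \<Sum>J\<in>?A. tensor_power x I * M I J * tensor_power x J) = (\<Sum>t\<in>T. \<Prod>i\<in>#\<nu> t. x i)" for x
  proof -
    have "(\<Sum>I\<in>?A. \<Sum>J\<in>?A. tensor_power x I * M I J * tensor_power x J) =
      ((\<Sum>I\<in>?A. \<Sum>J\<in>?A. tensor_power x I * N I J * tensor_power x J)
       + (\<Sum>I\<in>?A. \<Sum>J\<in>?A. tensor_power x I * N J I * tensor_power x J)) / 2"
      unfolding M_def by (simp add: sum_divide_distrib sum.distrib[symmetric] field_simps)
    then show ?thesis unfolding N N' by simp
  qed
  moreover have "symmetric_matrix ?A M" unfolding symmetric_matrix_def M_def by simp
  ultimately show ?thesis unfolding represents_def by auto
qed

text \<open>The exponent of the monomial that arises when the cliques \<open>Ks\<close> are chosen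
  from the \<open>m\<close> factors in the expansion of \<open>f^m\<close>.\<close>

definition clique_mset :: "nat set list \<Rightarrow> nat multiset" where
  "clique_mset Ks = (\<Sum>K\<leftarrow>Ks. mset_set K)"

lemma sum_power_lists:
  fixes g :: "'k \<Rightarrow> real"
  assumes "finite A"
  shows "(\<Sum>K\<in>A. g K) ^ m = (\<Sum>Ks | set Ks \<subseteq> A \<and> length Ks = m. \<Prod>K\<leftarrow>Ks. g K)"
proof (induction m)
  case 0
  have "{Ks. set Ks \<subseteq> A \<and> length Ks = 0} = {[]}" by auto
  then show ?case by simp
next
  case (Suc m)
  let ?L = "{Ks. set Ks \<subseteq> A \<and> length Ks = m}"
  have "(\<Sum>Ks | set Ks \<subseteq> A \<and> length Ks = Suc m. \<Prod>K\<leftarrow>Ks. g K) = (\<Sum>(Ks, K)\<in>?L \<times> A. g K * (\<Prod>K\<leftarrow>Ks. g K))"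
    unfolding lists_length_Suc_eq
    by (subst sum.reindex) (auto simp: inj_on_def split_beta)
  also have "\<dots> = (\<Sum>K\<in>A. g K) * (\<Sum>K\<in>A. g K) ^ m"
    unfolding Suc sum_product sum.cartesian_product[symmetric] by (rule sum.swap)
  finally show ?case by simp
qed

lemma prod_list_clique_mset:
  fixes x :: "nat \<Rightarrow> real"
  assumes "\<And>K. K \<in> set Ks \<Longrightarrow> finite K"
  shows "(\<Prod>K\<leftarrow>Ks. \<Prod>i\<in>K. x i) = (\<Prod>i\<in>#clique_mset Ks. x i)"
  using assms by (induction Ks) (auto simp: clique_mset_def prod_unfold_prod_mset)

lemma set_size_clique_mset:
  assumes "set Ks \<subseteq> nsets V k"
  shows "set_mset (clique_mset Ks) \<subseteq> V" "size (clique_mset Ks) = k * length Ks"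
  using assms by (induction Ks) (auto simp: clique_mset_def nsets_def)

subsection \<open>Counting cliques in sparse graphs\<close>

definition common_nbrs :: "nat \<Rightarrow> nat set set \<Rightarrow> nat set \<Rightarrow> nat set" where
  "common_nbrs n E S = {w \<in> {..<n}. \<forall>u\<in>S. {u, w} \<in> E}"

text \<open>The pairs are ordered, so an edge with both ends in the intersection of \<open>A\<close>
  and \<open>B\<close> counts twice; hence the factor 2 in
  \<open>card_edge_pairs_le\<close>.\<close>

definition edge_pairs :: "nat set set \<Rightarrow> nat set \<Rightarrow> nat set \<Rightarrow> (nat \<times> nat) set" where
  "edge_pairs E A B = {(u, v). u \<in> A \<and> v \<in> B \<and> {u, v} \<in> E}"

definition cliques :: "nat \<Rightarrow> nat set set \<Rightarrow> nat \<Rightarrow> nat set set" where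
  "cliques n E k = {S \<in> nsets {..<n} k. nsets S 2 \<subseteq> E}"

lemma four_cliques_eq: "four_cliques n E = cliques n E 4"
  by (simp add: four_cliques_def cliques_def)

lemma finite_cliques: "finite (cliques n E k)"
  by (simp add: cliques_def finite_imp_finite_nsets)

text \<open>The first set absorbs as much of \<open>X\<close> as possible, and what remains fits
  under the other sets. For a row index this means that half of a monomial consists of one subset,
  again a clique, of each of the \<open>m\<close> cliques.\<close>

lemma sub_multiset_clique_mset:
  assumes "X \<subseteq># clique_mset Ks" "\<And>K. K \<in> set Ks \<Longrightarrow> finite K"
  shows "\<exists>Ss. list_all2 (\<subseteq>) Ss Ks \<and> X = clique_mset Ss"
  using assms
proof (induction Ks arbitrary: X)
  case Nil
  then show ?case by (intro exI[of _ "[]"]) (auto simp: clique_mset_def)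
next
  case (Cons K Ks)
  let ?Y = "X \<inter># mset_set K"
  have K: "finite K" using Cons.prems by simp
  \<comment> \<open>Below \<open>mset_set K\<close> no multiplicity exceeds one, so the absorbed
    part is a set.\<close>
  have "?Y = mset_set (set_mset ?Y)"
  proof (rule multiset_eqI)
    fix i
    have "count (mset_set K) i \<le> 1" using K by (cases "i \<in> K") auto
    then have "count ?Y i \<le> 1" by simp
    moreover have "count (mset_set (set_mset ?Y)) i = (if i \<in># ?Y then 1 else 0)" by auto
    ultimately show "count ?Y i = count (mset_set (set_mset ?Y)) i"
      by (metis One_nat_def Suc_leI count_greater_zero_iff le_antisym not_in_iff)
  qed
  moreover have "X - ?Y \<subseteq># clique_mset Ks"
    using Cons.prems(1) unfolding clique_mset_def
    by (auto simp: subseteq_mset_def) (metis add.commute le_diff_conv min.cobounded1 min_def order_refl)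
  then obtain Ss where Ss: "list_all2 (\<subseteq>) Ss Ks" "X - ?Y = clique_mset Ss"
    using Cons by (metis list.set_intros(2))
  moreover have "X = ?Y + (X - ?Y)" by (rule multiset_eqI) simp
  ultimately have "X = clique_mset (set_mset ?Y # Ss)"
    unfolding clique_mset_def by (metis list.simps(9) sum_list.Cons)
  moreover have "set_mset ?Y \<subseteq> K" using K by auto
  ultimately show ?case using Ss by (intro exI[of _ "set_mset ?Y # Ss"]) auto
qed

text \<open>The deterministic conditions that a random graph satisfies with high probability. With
  \<open>n = r ^ 3\<close> and edge probability \<open>1 / r\<close>, the mean codegree of
  \<open>S\<close> is about \<open>r ^ (3 - card S)\<close>, and the mean number of edges between
  \<open>A\<close> and \<open>B\<close> is about \<open>card A * card B / r\<close>. The additional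
  \<open>card A + card B\<close> pays for a union bound over all pairs of vertex sets.\<close>

locale sparse_graph =
  fixes n :: nat and E :: "nat set set" and r L :: real
  assumes r: "r \<ge> 1" "real n = r ^ 3" and L: "L \<ge> 1"
    and edges: "E \<subseteq> nsets {..<n} 2"
    and card_common_nbrs: "\<And>S. \<lbrakk>S \<subseteq> {..<n}; 1 \<le> card S; card S \<le> 3\<rbrakk>
          \<Longrightarrow> real (card (common_nbrs n E S)) \<le> L * r ^ (3 - card S)"
    and card_edge_pairs: "\<And>A B. \<lbrakk>A \<subseteq> {..<n}; B \<subseteq> {..<n}\<rbrakk>
          \<Longrightarrow> real (card (edge_pairs E A B)) \<le> L * (real (card A) + real (card B) + real (card A) * real (card B) / r)"
begin

text \<open>Removing a vertex from a clique leaves a smaller clique that has this vertex as a common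
  neighbour.\<close>

lemma card_cliques_Suc:
  assumes "k \<le> 3"
  shows "real (card (cliques n E (Suc k))) \<le> real (card (cliques n E k)) * (L * r ^ (3 - k))"
proof -
  have "cliques n E (Suc k) \<subseteq> (\<Union>S\<in>cliques n E k. (\<lambda>v. insert v S) ` common_nbrs n E S)"
  proof
    fix T assume T: "T \<in> cliques n E (Suc k)"
    then have "T \<noteq> {}" by (auto simp: cliques_def nsets_def)
    then obtain v where v: "v \<in> T" by blast
    have sub: "{u, v} \<in> E" if "u \<in> T - {v}" for u
    proof -
      have "{u, v} \<in> nsets T 2" using that v by auto
      then show ?thesis using T unfolding cliques_def by blast
    qed
    have "T - {v} \<in> cliques n E k"
      using T v nsets_mono[of "T - {v}" T 2] unfolding cliques_def nsets_def by auto
    moreover have "v \<in> common_nbrs n E (T - {v})"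
      using T v sub unfolding common_nbrs_def cliques_def nsets_def by auto
    ultimately show "T \<in> (\<Union>S\<in>cliques n E k. (\<lambda>v. insert v S) ` common_nbrs n E S)"
      using v by (metis (no_types, lifting) UN_I imageI insert_Diff)
  qed
  moreover have fin: "finite (common_nbrs n E S)" for S unfolding common_nbrs_def by auto
  ultimately have "card (cliques n E (Suc k)) \<le> card (\<Union>S\<in>cliques n E k. (\<lambda>v. insert v S) ` common_nbrs n E S)"
    by (intro card_mono) (auto simp: finite_cliques)
  also have "\<dots> \<le> (\<Sum>S\<in>cliques n E k. card ((\<lambda>v. insert v S) ` common_nbrs n E S))"
    by (rule card_UN_le[OF finite_cliques])
  also have "\<dots> \<le> (\<Sum>S\<in>cliques n E k. card (common_nbrs n E S))"
    by (intro sum_mono card_image_le fin)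
  finally have "real (card (cliques n E (Suc k))) \<le> (\<Sum>S\<in>cliques n E k. real (card (common_nbrs n E S)))"
    by (metis of_nat_mono of_nat_sum)
  also have "\<dots> \<le> (\<Sum>S\<in>cliques n E k. L * r ^ (3 - k))"
  proof (rule sum_mono)
    fix S assume "S \<in> cliques n E k"
    then have S: "S \<subseteq> {..<n}" "card S = k" "finite S" by (auto simp: cliques_def nsets_def)
    show "real (card (common_nbrs n E S)) \<le> L * r ^ (3 - k)"
    \<comment> \<open>The codegree hypothesis starts at one vertex. For the empty set adjacency is
      vacuous and all \<open>n = r ^ 3\<close> vertices qualify.\<close>
    proof (cases "k = 0")
      case True
      then have "common_nbrs n E S = {..<n}" using S by (auto simp: common_nbrs_def)
      then show ?thesis using r L True by simp
    next
      case False
      then show ?thesis using card_common_nbrs[of S] S assms by simp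
    qed
  qed
  finally show ?thesis by simp
qed

text \<open>Iterating \<open>card_cliques_Suc\<close> gives the exponents 0, 3, 5, 6, 6 of
  \<open>r\<close> for \<open>k\<close> from 0 to 4. All are at most \<open>3 + k\<close>, with
  equality for edges and triangles; this uniform shape suits the weight \<open>1 / r\<close> per
  vertex.\<close>

lemma card_cliques_le:
  assumes "k \<le> 4"
  shows "real (card (cliques n E k)) \<le> L ^ 4 * r ^ (3 + k)"
proof -
  have "cliques n E 0 \<subseteq> {{}}" by (auto simp: cliques_def nsets_def)
  then have c0: "real (card (cliques n E 0)) \<le> L ^ 0 * r ^ 0"
    using card_mono[of "{{}}" "cliques n E 0"] by simp
  have step: "real (card (cliques n E (Suc k))) \<le> L ^ Suc k * r ^ (j + (3 - k))"
    if "k \<le> 3" "real (card (cliques n E k)) \<le> L ^ k * r ^ j" for k j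
  proof -
    have "real (card (cliques n E (Suc k))) \<le> real (card (cliques n E k)) * (L * r ^ (3 - k))"
      by (rule card_cliques_Suc[OF that(1)])
    also have "\<dots> \<le> (L ^ k * r ^ j) * (L * r ^ (3 - k))"
      using that(2) r L by (intro mult_right_mono) auto
    finally show ?thesis by (simp add: power_add mult_ac)
  qed
  have c1: "real (card (cliques n E 1)) \<le> L ^ 1 * r ^ 3" using step[OF _ c0] by simp
  have c2: "real (card (cliques n E 2)) \<le> L ^ 2 * r ^ 5" using step[OF _ c1] by (simp add: numeral_2_eq_2)
  have c3: "real (card (cliques n E 3)) \<le> L ^ 3 * r ^ 6" using step[OF _ c2] by simp
  have c4: "real (card (cliques n E 4)) \<le> L ^ 4 * r ^ 6" using step[OF _ c3] by simp
  have weaken: "real (card (cliques n E k)) \<le> L ^ 4 * r ^ (3 + k)"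
    if "real (card (cliques n E k)) \<le> L ^ i * r ^ j" "i \<le> 4" "j \<le> 3 + k" for i j
  proof -
    have "L ^ i * r ^ j \<le> L ^ 4 * r ^ (3 + k)"
      using that L r by (intro mult_mono power_increasing) auto
    then show ?thesis using that(1) by linarith
  qed
  consider "k = 0" | "k = 1" | "k = 2" | "k = 3" | "k = 4" using assms by linarith
  then show ?thesis
  proof cases
    case 1
    show ?thesis by (rule weaken[of 0 0]) (use c0 1 in auto)
  next
    case 2
    show ?thesis by (rule weaken[of 1 3]) (use c1 2 in auto)
  next
    case 3
    show ?thesis by (rule weaken[of 2 5]) (use c2 3 in auto)
  next
    case 4
    show ?thesis by (rule weaken[of 3 6]) (use c3 4 in auto)
  next
    case 5
    show ?thesis by (rule weaken[of 4 6]) (use c4 5 in auto)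
  qed
qed

definition small_cliques :: "nat set set" where
  "small_cliques = (\<Union>k\<le>4. cliques n E k)"

lemma finite_small_cliques: "finite small_cliques"
  by (simp add: small_cliques_def finite_cliques)

text \<open>
  The weight \<open>1 / r\<close> per vertex is chosen such that, up to powers of \<open>L\<close>, no clique size
  contributes more than the edges do.
\<close>

lemma weighted_small_cliques:
  "(\<Sum>S\<in>small_cliques. (1 / r) ^ card S) \<le> 5 * L ^ 4 * r ^ 3"
proof -
  have "(\<Sum>S\<in>small_cliques. (1 / r) ^ card S) = (\<Sum>k\<le>4. \<Sum>S\<in>cliques n E k. (1 / r) ^ card S)"
    unfolding small_cliques_def
    by (intro sum.UNION_disjoint) (auto simp: finite_cliques, auto simp: cliques_def nsets_def)
  also have "\<dots> \<le> (\<Sum>k\<le>(4::nat). L ^ 4 * r ^ 3)"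
  proof (rule sum_mono)
    fix k :: nat assume k: "k \<in> {..4}"
    have "(\<Sum>S\<in>cliques n E k. (1 / r) ^ card S) = (\<Sum>S\<in>cliques n E k. (1 / r) ^ k)"
      by (intro sum.cong) (auto simp: cliques_def nsets_def)
    also have "\<dots> = real (card (cliques n E k)) / r ^ k" by (simp add: power_divide)
    also have "\<dots> \<le> L ^ 4 * r ^ 3"
      using card_cliques_le[of k] k r by (simp add: pos_divide_le_eq power_add mult_ac)
    finally show "(\<Sum>S\<in>cliques n E k. (1 / r) ^ card S) \<le> L ^ 4 * r ^ 3" .
  qed
  finally show ?thesis by simp
qed

text \<open>The halves of monomials of \<open>f^m\<close>; every index of a nonzero column of the
  coefficient matrix is among them.\<close>

definition clique_rows :: "nat \<Rightarrow> nat list set" where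
  "clique_rows m = {I \<in> tuples n (2 * m).
     \<exists>Ks. set Ks \<subseteq> four_cliques n E \<and> length Ks = m \<and> mset I \<subseteq># clique_mset Ks}"

text \<open>A row index is an ordering of a union of \<open>m\<close> cliques of size at most 4
  whose sizes add up to \<open>2 * m\<close>. The orderings cost a factorial, and the choices of
  cliques are counted by a generating function with weight \<open>1 / r\<close> per vertex.\<close>

lemma card_clique_rows: "real (card (clique_rows m)) \<le> fact (2 * m) * (5 * L ^ 4 * r ^ 5) ^ m"
proof -
  let ?A = "{Ss. set Ss \<subseteq> small_cliques \<and> length Ss = m}"
  define W where "W = {Ss \<in> ?A. size (clique_mset Ss) = 2 * m}"
  have finA: "finite ?A" using finite_small_cliques by (rule finite_lists_length_eq)
  have finW: "finite W" unfolding W_def using finA by (rule rev_finite_subset) auto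
  have "clique_rows m \<subseteq> (\<Union>Ss\<in>W. permutations_of_multiset (clique_mset Ss))"
  proof
    fix I assume "I \<in> clique_rows m"
    then obtain Ks where I: "length I = 2 * m" and Ks: "set Ks \<subseteq> four_cliques n E" "length Ks = m"
      "mset I \<subseteq># clique_mset Ks" unfolding clique_rows_def tuples_def by blast
    have K: "finite K" "card K = 4" "K \<subseteq> {..<n}" "nsets K 2 \<subseteq> E" if "K \<in> set Ks" for K
    proof -
      have "K \<in> four_cliques n E" using Ks(1) that by blast
      then show "finite K" "card K = 4" "K \<subseteq> {..<n}" "nsets K 2 \<subseteq> E"
        by (simp_all add: four_cliques_def nsets_def[of _ 4])
    qed
    from sub_multiset_clique_mset[OF Ks(3) K(1)]
    obtain Ss where Ss: "list_all2 (\<subseteq>) Ss Ks" "mset I = clique_mset Ss" by auto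
    have "S \<in> small_cliques" if S: "S \<in> set Ss" for S
    proof -
      obtain i where i: "i < length Ss" "S = Ss ! i" using S by (auto simp: in_set_conv_nth)
      then have SK: "S \<subseteq> Ks ! i" "Ks ! i \<in> set Ks"
        using Ss(1) by (simp_all add: list_all2_conv_all_nth)
      have "finite S" "card S \<le> 4" "S \<subseteq> {..<n}"
        using finite_subset[OF SK(1)] card_mono[OF _ SK(1)] K[OF SK(2)] SK(1) by simp_all
      moreover have "nsets S 2 \<subseteq> E" using nsets_mono[OF SK(1), of 2] K(4)[OF SK(2)] by simp
      ultimately have "S \<in> cliques n E (card S)" "card S \<le> 4"
        by (simp_all add: cliques_def nsets_def[of _ "card S"])
      then show ?thesis by (auto simp: small_cliques_def)
    qed
    moreover have "size (clique_mset Ss) = 2 * m" using I by (simp flip: Ss(2))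
    moreover have "length Ss = m" using list_all2_lengthD[OF Ss(1)] Ks(2) by simp
    ultimately have "Ss \<in> W" unfolding W_def by blast
    then show "I \<in> (\<Union>Ss\<in>W. permutations_of_multiset (clique_mset Ss))"
      using Ss(2) by (intro UN_I) (simp_all add: permutations_of_multiset_def)
  qed
  then have "card (clique_rows m) \<le> card (\<Union>Ss\<in>W. permutations_of_multiset (clique_mset Ss))"
    using finW by (intro card_mono) auto
  also have "\<dots> \<le> (\<Sum>Ss\<in>W. card (permutations_of_multiset (clique_mset Ss)))"
    by (rule card_UN_le[OF finW])
  also have "\<dots> \<le> (\<Sum>Ss\<in>W. fact (2 * m))"
    by (intro sum_mono) (auto simp: W_def card_permutations_of_multiset)
  finally have "real (card (clique_rows m)) \<le> real (card W * fact (2 * m))"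
    unfolding sum_constant of_nat_le_iff by simp
  also have "\<dots> = fact (2 * m) * real (card W)" by simp
  also have "real (card W) \<le> (5 * L ^ 4 * r ^ 5) ^ m"
  proof -
    have fin: "finite S" if "S \<in> small_cliques" for S
      using that by (auto simp: small_cliques_def cliques_def nsets_def)
    have weight: "(\<Prod>S\<leftarrow>Ss. (1 / r) ^ card S) = (1 / r) ^ size (clique_mset Ss)"
      if "set Ss \<subseteq> small_cliques" for Ss
      using that fin by (induction Ss) (auto simp: clique_mset_def power_add)
    \<comment> \<open>On \<open>W\<close> the weights multiply to exactly
      \<open>(1 / r) ^ (2 * m)\<close>, so the count becomes a weighted sum.\<close>
    have "real (card W) = r ^ (2 * m) * (\<Sum>Ss\<in>W. \<Prod>S\<leftarrow>Ss. (1 / r) ^ card S)"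
    proof -
      have "(\<Sum>Ss\<in>W. \<Prod>S\<leftarrow>Ss. (1 / r) ^ card S) = (\<Sum>Ss\<in>W. (1 / r) ^ (2 * m))"
        by (intro sum.cong) (auto simp: W_def weight)
      then show ?thesis using r by (simp add: power_divide)
    qed
    \<comment> \<open>Giving up the constraint on the total size makes the sum factor into an
      \<open>m\<close>-th power.\<close>
    also have "\<dots> \<le> r ^ (2 * m) * (\<Sum>Ss\<in>?A. \<Prod>S\<leftarrow>Ss. (1 / r) ^ card S)"
      using r finA by (intro mult_left_mono sum_mono2) (auto simp: W_def weight)
    also have "\<dots> = r ^ (2 * m) * (\<Sum>S\<in>small_cliques. (1 / r) ^ card S) ^ m"
      by (simp add: sum_power_lists[OF finite_small_cliques])
    also have "\<dots> \<le> r ^ (2 * m) * (5 * L ^ 4 * r ^ 3) ^ m"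
      using r by (intro mult_left_mono power_mono weighted_small_cliques sum_nonneg) auto
    also have "\<dots> = (5 * L ^ 4 * r ^ 5) ^ m"
      by (simp add: power_mult power_mult_distrib[symmetric] flip: power_add)
        (simp add: eval_nat_numeral mult_ac)
    finally show ?thesis .
  qed
  finally show ?thesis by simp
qed

end

subsection \<open>The clique polynomial on the unit sphere\<close>

lemma card_pairs_sum:
  assumes "finite A" "finite B"
  shows "card {(a, b). a \<in> A \<and> b \<in> B \<and> P a b} = (\<Sum>b\<in>B. card {a \<in> A. P a b})"
proof -
  have "card {(a, b). a \<in> A \<and> b \<in> B \<and> P a b} = card (SIGMA b:B. {a \<in> A. P a b})"
    by (intro bij_betw_same_card[of prod.swap] bij_betwI[of _ _ _ prod.swap]) auto
  then show ?thesis using assms by (simp add: card_SigmaI)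
qed

lemma sum_card_incidence:
  assumes "finite A" "finite B"
  shows "(\<Sum>b\<in>B. card {a \<in> A. P a b}) = (\<Sum>a\<in>A. card {b \<in> B. P a b})"
proof -
  have "(\<Sum>b\<in>B. card {a \<in> A. P a b}) = (\<Sum>b\<in>B. \<Sum>a\<in>A. if P a b then 1 else 0)"
    using assms by (simp add: sum.If_cases Int_def)
  also have "\<dots> = (\<Sum>a\<in>A. \<Sum>b\<in>B. if P a b then 1 else 0)" by (rule sum.swap)
  also have "\<dots> = (\<Sum>a\<in>A. card {b \<in> B. P a b})" using assms by (simp add: sum.If_cases Int_def)
  finally show ?thesis .
qed

context sparse_graph
begin

lemma edge_vertices:
  assumes "{u, v} \<in> E"
  shows "u < n" "v < n" "u \<noteq> v"
proof -
  have "{u, v} \<in> nsets {..<n} 2" using assms edges by blast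
  then show "u < n" "v < n" "u \<noteq> v" unfolding doubleton_in_nsets_2 by simp_all
qed

lemma finite_common_nbrs: "finite (common_nbrs n E S)"
  by (simp add: common_nbrs_def)

definition triangles :: "nat set \<Rightarrow> nat set \<Rightarrow> nat set \<Rightarrow> (nat \<times> nat \<times> nat) set" where
  "triangles S\<^sub>1 S\<^sub>2 S\<^sub>3 = {(i, j, k). i \<in> S\<^sub>1 \<and> j \<in> S\<^sub>2 \<and> k \<in> S\<^sub>3 \<and> {i, j} \<in> E \<and> {i, k} \<in> E \<and> {j, k} \<in> E}"

lemma finite_triangles:
  assumes "finite S\<^sub>1" "finite S\<^sub>2" "finite S\<^sub>3"
  shows "finite (triangles S\<^sub>1 S\<^sub>2 S\<^sub>3)"
  by (rule finite_subset[of _ "S\<^sub>1 \<times> S\<^sub>2 \<times> S\<^sub>3"]) (use assms in \<open>auto simp: triangles_def\<close>)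

text \<open>
  Applying the edge count inside the neighbourhood of every \<open>k \<in> S\<^sub>3\<close> leaves the number of
  paths \<open>i - k - j\<close>, which the codegrees control. Replacing \<open>S\<^sub>2\<close> by its part \<open>S\<^sub>2'\<close>
  adjacent to \<open>S\<^sub>1\<close> handles the case that \<open>S\<^sub>1\<close> is much smaller than \<open>S\<^sub>2\<close>.
\<close>

lemma card_triangles:
  assumes sub: "S\<^sub>1 \<subseteq> {..<n}" "S\<^sub>2 \<subseteq> {..<n}" "S\<^sub>3 \<subseteq> {..<n}"
    and card: "real (card S\<^sub>1) \<le> \<alpha>\<^sup>2" "real (card S\<^sub>2) \<le> \<beta>\<^sup>2" "real (card S\<^sub>3) \<le> \<gamma>\<^sup>2"
    and order: "1 \<le> \<alpha>" "\<alpha> \<le> \<beta>" "\<beta> \<le> \<gamma>"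
  shows "real (card (triangles S\<^sub>1 S\<^sub>2 S\<^sub>3)) \<le> 10 * L ^ 3 * (\<alpha> * \<beta> * \<gamma>\<^sup>2)"
proof -
  define S\<^sub>2' where "S\<^sub>2' = {j \<in> S\<^sub>2. \<exists>i\<in>S\<^sub>1. {i, j} \<in> E}"
  define N where "N S k = {i \<in> S. {i, k} \<in> E}" for S k
  have fin: "finite S\<^sub>1" "finite S\<^sub>2" "finite S\<^sub>3" "finite S\<^sub>2'" "S\<^sub>2' \<subseteq> {..<n}"
    using sub by (auto intro: finite_subset simp: S\<^sub>2'_def)
  have finN: "finite (N S k)" if "finite S" for S k using that by (simp add: N_def)
  have S2'_le: "real (card S\<^sub>2') \<le> \<beta>\<^sup>2"
    using card_mono[OF fin(2), of S\<^sub>2'] card(2) unfolding S\<^sub>2'_def by fastforce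
  have "S\<^sub>2' \<subseteq> (\<Union>i\<in>S\<^sub>1. common_nbrs n E {i})"
    using sub unfolding S\<^sub>2'_def common_nbrs_def by auto
  then have "card S\<^sub>2' \<le> (\<Sum>i\<in>S\<^sub>1. card (common_nbrs n E {i}))"
    by (intro order_trans[OF card_mono card_UN_le[OF fin(1)]]) (use fin(1) finite_common_nbrs in auto)
  then have "real (card S\<^sub>2') \<le> (\<Sum>i\<in>S\<^sub>1. real (card (common_nbrs n E {i})))"
    by (simp flip: of_nat_sum)
  also have "\<dots> \<le> (\<Sum>i\<in>S\<^sub>1. L * r\<^sup>2)"
    using sub(1) card_common_nbrs[of "{i}" for i] by (intro sum_mono) auto
  also have "\<dots> \<le> \<alpha>\<^sup>2 * (L * r\<^sup>2)" using card(1) L r by (simp add: mult_right_mono)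
  \<comment> \<open>Degrees bound \<open>S\<^sub>2'\<close> by
    \<open>\<alpha>\<^sup>2 * (L * r\<^sup>2)\<close>, inclusion in \<open>S\<^sub>2\<close> bounds
    it by \<open>\<beta>\<^sup>2\<close>; the geometric mean of the two is of order
    \<open>r * \<alpha> * \<beta>\<close>.\<close>
  finally have "(real (card S\<^sub>2'))\<^sup>2 \<le> (\<alpha>\<^sup>2 * (L * r\<^sup>2)) * \<beta>\<^sup>2"
    unfolding power2_eq_square[of "real (card S\<^sub>2')"] using S2'_le by (intro mult_mono) (use L in auto)
  also have "\<dots> \<le> (\<alpha>\<^sup>2 * (L\<^sup>2 * r\<^sup>2)) * \<beta>\<^sup>2"
    using L by (intro mult_right_mono mult_left_mono) (auto simp: power2_eq_square)
  also have "\<dots> = (L * r * (\<alpha> * \<beta>))\<^sup>2" by (simp add: power_mult_distrib mult_ac)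
  finally have S2'_le': "real (card S\<^sub>2') \<le> L * r * (\<alpha> * \<beta>)"
    by (rule power2_le_imp_le) (use L r order in auto)
  let ?e13 = "real (card (edge_pairs E S\<^sub>1 S\<^sub>3))" and ?e23 = "real (card (edge_pairs E S\<^sub>2' S\<^sub>3))"
  have e: "(\<Sum>k\<in>S\<^sub>3. real (card (N S k))) = real (card (edge_pairs E S S\<^sub>3))" if "finite S" for S
    unfolding edge_pairs_def N_def card_pairs_sum[OF that fin(3)] by simp
  have "card (triangles S\<^sub>1 S\<^sub>2 S\<^sub>3) \<le> card (SIGMA k:S\<^sub>3. edge_pairs E (N S\<^sub>1 k) (N S\<^sub>2' k))"
  proof (rule card_inj_on_le)
    show "inj_on (\<lambda>(i, j, k). (k, i, j)) (triangles S\<^sub>1 S\<^sub>2 S\<^sub>3)" by (auto simp: inj_on_def)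
    show "(\<lambda>(i, j, k). (k, i, j)) ` triangles S\<^sub>1 S\<^sub>2 S\<^sub>3 \<subseteq> (SIGMA k:S\<^sub>3. edge_pairs E (N S\<^sub>1 k) (N S\<^sub>2' k))"
      by (auto simp: triangles_def edge_pairs_def N_def S\<^sub>2'_def)
    have "edge_pairs E (N S\<^sub>1 k) (N S\<^sub>2' k) \<subseteq> S\<^sub>1 \<times> S\<^sub>2'" for k by (auto simp: edge_pairs_def N_def)
    then have "finite (edge_pairs E (N S\<^sub>1 k) (N S\<^sub>2' k))" for k
      using fin(1,4) by (meson finite_SigmaI finite_subset)
    then show "finite (SIGMA k:S\<^sub>3. edge_pairs E (N S\<^sub>1 k) (N S\<^sub>2' k))" using fin(3) by blast
  qed
  also have "\<dots> = (\<Sum>k\<in>S\<^sub>3. card (edge_pairs E (N S\<^sub>1 k) (N S\<^sub>2' k)))"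
  proof -
    have "edge_pairs E (N S\<^sub>1 k) (N S\<^sub>2' k) \<subseteq> S\<^sub>1 \<times> S\<^sub>2'" for k by (auto simp: edge_pairs_def N_def)
    then have "finite (edge_pairs E (N S\<^sub>1 k) (N S\<^sub>2' k))" for k
      using fin(1,4) by (meson finite_SigmaI finite_subset)
    then show ?thesis using fin(3) by (simp add: card_SigmaI)
  qed
  finally have "real (card (triangles S\<^sub>1 S\<^sub>2 S\<^sub>3)) \<le> (\<Sum>k\<in>S\<^sub>3. real (card (edge_pairs E (N S\<^sub>1 k) (N S\<^sub>2' k))))"
    by (simp flip: of_nat_sum)
  also have "\<dots> \<le> (\<Sum>k\<in>S\<^sub>3. L * (real (card (N S\<^sub>1 k)) + real (card (N S\<^sub>2' k))
      + real (card (N S\<^sub>1 k)) * real (card (N S\<^sub>2' k)) / r))"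
    using sub(1) fin(5) by (intro sum_mono card_edge_pairs) (auto simp: N_def)
  also have "\<dots> = L * (?e13 + ?e23 + (\<Sum>k\<in>S\<^sub>3. real (card (N S\<^sub>1 k)) * real (card (N S\<^sub>2' k))) / r)"
    by (simp add: sum_distrib_left[symmetric] sum.distrib sum_divide_distrib[symmetric] e fin)
  also have "(\<Sum>k\<in>S\<^sub>3. real (card (N S\<^sub>1 k)) * real (card (N S\<^sub>2' k))) \<le> L * r * (\<alpha>\<^sup>2 * \<beta>\<^sup>2) + ?e13"
  proof -
    have "(\<Sum>k\<in>S\<^sub>3. card (N S\<^sub>1 k) * card (N S\<^sub>2' k)) = (\<Sum>k\<in>S\<^sub>3. card {p \<in> S\<^sub>1 \<times> S\<^sub>2'. {fst p, k} \<in> E \<and> {snd p, k} \<in> E})"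
    proof (intro sum.cong refl)
      fix k
      have "{p \<in> S\<^sub>1 \<times> S\<^sub>2'. {fst p, k} \<in> E \<and> {snd p, k} \<in> E} = N S\<^sub>1 k \<times> N S\<^sub>2' k"
        by (auto simp: N_def)
      then show "card (N S\<^sub>1 k) * card (N S\<^sub>2' k) = card {p \<in> S\<^sub>1 \<times> S\<^sub>2'. {fst p, k} \<in> E \<and> {snd p, k} \<in> E}"
        by (simp add: card_cartesian_product)
    qed
    also have "\<dots> = (\<Sum>p\<in>S\<^sub>1 \<times> S\<^sub>2'. card {k \<in> S\<^sub>3. {fst p, k} \<in> E \<and> {snd p, k} \<in> E})"
      using fin by (intro sum_card_incidence) auto
    finally have "(\<Sum>k\<in>S\<^sub>3. real (card (N S\<^sub>1 k)) * real (card (N S\<^sub>2' k)))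
        = (\<Sum>p\<in>S\<^sub>1 \<times> S\<^sub>2'. real (card {k \<in> S\<^sub>3. {fst p, k} \<in> E \<and> {snd p, k} \<in> E}))"
      by (metis (mono_tags, lifting) of_nat_mult of_nat_sum sum.cong)
    also have "\<dots> = (\<Sum>i\<in>S\<^sub>1. \<Sum>j\<in>S\<^sub>2'. real (card {k \<in> S\<^sub>3. {i, k} \<in> E \<and> {j, k} \<in> E}))"
      by (simp add: sum.cartesian_product split_beta)
    \<comment> \<open>Paths with distinct ends are bounded by the codegree. The degenerate ones with
      \<open>i = j\<close> are single edges between \<open>S\<^sub>1\<close> and
      \<open>S\<^sub>3\<close>.\<close>
    also have "\<dots> \<le> (\<Sum>i\<in>S\<^sub>1. \<Sum>j\<in>S\<^sub>2'. L * r + (if i = j then real (card {k \<in> S\<^sub>3. {i, k} \<in> E}) else 0))"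
    proof (intro sum_mono)
      fix i j assume ij: "i \<in> S\<^sub>1" "j \<in> S\<^sub>2'"
      show "real (card {k \<in> S\<^sub>3. {i, k} \<in> E \<and> {j, k} \<in> E}) \<le> L * r + (if i = j then real (card {k \<in> S\<^sub>3. {i, k} \<in> E}) else 0)"
      proof (cases "i = j")
        case True
        then show ?thesis using L r by simp
      next
        case False
        have "card {k \<in> S\<^sub>3. {i, k} \<in> E \<and> {j, k} \<in> E} \<le> card (common_nbrs n E {i, j})"
          using sub(3) finite_common_nbrs by (intro card_mono) (auto simp: common_nbrs_def)
        moreover have "real (card (common_nbrs n E {i, j})) \<le> L * r ^ (3 - card {i, j})"
          using ij sub(1) fin(5) False by (intro card_common_nbrs) auto
        ultimately show ?thesis using False by simp
      qed
    qed
    also have "\<dots> = real (card S\<^sub>1) * real (card S\<^sub>2') * (L * r) + (\<Sum>i\<in>S\<^sub>1. \<Sum>j\<in>S\<^sub>2'. if i = j then real (card {k \<in> S\<^sub>3. {i, k} \<in> E}) else 0)"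
      by (simp add: sum.distrib)
    also have "\<dots> \<le> \<alpha>\<^sup>2 * \<beta>\<^sup>2 * (L * r) + ?e13"
    proof (intro add_mono mult_right_mono mult_mono card S2'_le)
      have "(\<Sum>i\<in>S\<^sub>1. \<Sum>j\<in>S\<^sub>2'. if i = j then real (card {k \<in> S\<^sub>3. {i, k} \<in> E}) else 0) \<le> (\<Sum>i\<in>S\<^sub>1. real (card {k \<in> S\<^sub>3. {i, k} \<in> E}))"
        using fin by (intro sum_mono) auto
      also have "\<dots> = real (\<Sum>k\<in>S\<^sub>3. card {i \<in> S\<^sub>1. {i, k} \<in> E})"
        unfolding sum_card_incidence[OF fin(1,3)] by simp
      also have "\<dots> = ?e13" unfolding edge_pairs_def card_pairs_sum[OF fin(1,3)] ..
      finally show "(\<Sum>i\<in>S\<^sub>1. \<Sum>j\<in>S\<^sub>2'. if i = j then real (card {k \<in> S\<^sub>3. {i, k} \<in> E}) else 0) \<le> ?e13" .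
    qed (use L r in auto)
    finally show ?thesis by (simp add: mult_ac)
  qed
  finally have main: "real (card (triangles S\<^sub>1 S\<^sub>2 S\<^sub>3)) \<le> L * (?e13 + ?e23 + (L * r * (\<alpha>\<^sup>2 * \<beta>\<^sup>2) + ?e13) / r)"
    using L r by (auto simp: divide_right_mono mult_left_mono)
  define P where "P = \<alpha> * \<beta> * \<gamma>\<^sup>2"
  have pos: "0 < \<alpha>" "0 < \<beta>" "0 < \<gamma>" "1 \<le> \<beta>" "1 \<le> \<gamma>" using order by auto
  have ab: "1 \<le> \<alpha> * \<beta>" using order pos by (simp add: mult_ge1_I)
  have sq: "\<alpha>\<^sup>2 \<le> \<gamma>\<^sup>2" "\<beta>\<^sup>2 \<le> \<gamma>\<^sup>2" "\<alpha>\<^sup>2 \<le> \<alpha> * \<beta>" "\<alpha> * \<beta> \<le> \<gamma>\<^sup>2"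
    using order pos by (auto intro!: power_mono mult_mono simp: power2_eq_square)
  have P: "\<gamma>\<^sup>2 \<le> P" "\<alpha>\<^sup>2 * \<gamma>\<^sup>2 \<le> P" "\<alpha>\<^sup>2 * \<beta>\<^sup>2 \<le> P" "0 \<le> P"
    unfolding P_def using ab sq pos mult_right_mono[of 1 "\<alpha> * \<beta>" "\<gamma>\<^sup>2"]
      mult_right_mono[of "\<alpha>\<^sup>2" "\<alpha> * \<beta>" "\<gamma>\<^sup>2"] mult_mono[of "\<alpha>\<^sup>2" "\<alpha> * \<beta>" "\<beta>\<^sup>2" "\<gamma>\<^sup>2"] by auto
  have LP: "P \<le> L * P" using L P(4) mult_right_mono[of 1 L P] by simp
  have e13: "?e13 \<le> L * (3 * P)"
  proof -
    have "?e13 \<le> L * (real (card S\<^sub>1) + real (card S\<^sub>3) + real (card S\<^sub>1) * real (card S\<^sub>3) / r)"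
      by (rule card_edge_pairs[OF sub(1,3)])
    also have "\<dots> \<le> L * (P + P + P)"
    proof (intro mult_left_mono add_mono)
      have "real (card S\<^sub>1) * real (card S\<^sub>3) / r \<le> real (card S\<^sub>1) * real (card S\<^sub>3) / 1"
        using r by (intro divide_left_mono) auto
      also have "\<dots> \<le> \<alpha>\<^sup>2 * \<gamma>\<^sup>2" using card by (auto intro: mult_mono)
      finally show "real (card S\<^sub>1) * real (card S\<^sub>3) / r \<le> P" using P by linarith
    qed (use card sq P L in auto)
    finally show ?thesis by simp
  qed
  \<comment> \<open>The product term needs the bound \<open>S2'_le'\<close>: its factor
    \<open>r\<close> is cancelled by the density \<open>1 / r\<close>, whereas
    \<open>\<beta>\<^sup>2\<close> alone would be too large when \<open>\<beta>\<close> exceeds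
    \<open>r * \<alpha>\<close>.\<close>
  have e23: "?e23 \<le> L * (3 * (L * P))"
  proof -
    have "?e23 \<le> L * (real (card S\<^sub>2') + real (card S\<^sub>3) + real (card S\<^sub>2') * real (card S\<^sub>3) / r)"
      by (rule card_edge_pairs[OF fin(5) sub(3)])
    also have "\<dots> \<le> L * (L * P + L * P + L * P)"
    proof (intro mult_left_mono add_mono)
      have "real (card S\<^sub>2') * real (card S\<^sub>3) / r \<le> (L * r * (\<alpha> * \<beta>)) * \<gamma>\<^sup>2 / r"
        using r S2'_le' card L pos by (intro divide_right_mono mult_mono) auto
      also have "\<dots> = L * P" using r by (simp add: P_def)
      finally show "real (card S\<^sub>2') * real (card S\<^sub>3) / r \<le> L * P" .
    qed (use card S2'_le sq P LP L in auto)
    finally show ?thesis by simp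
  qed
  have "(L * r * (\<alpha>\<^sup>2 * \<beta>\<^sup>2) + ?e13) / r \<le> L * P + L * (3 * P)"
  proof -
    have "(L * r * (\<alpha>\<^sup>2 * \<beta>\<^sup>2) + ?e13) / r = L * (\<alpha>\<^sup>2 * \<beta>\<^sup>2) + ?e13 / r"
      using r by (simp add: add_divide_distrib)
    moreover have "?e13 / r \<le> ?e13 / 1" using r by (intro divide_left_mono) auto
    moreover have "L * (\<alpha>\<^sup>2 * \<beta>\<^sup>2) \<le> L * P" using P L by (intro mult_left_mono) auto
    ultimately show ?thesis using e13 by simp
  qed
  then have "?e13 + ?e23 + (L * r * (\<alpha>\<^sup>2 * \<beta>\<^sup>2) + ?e13) / r \<le> L * (7 * P + 3 * (L * P))"
    using e13 e23 by (simp add: algebra_simps)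
  also have "\<dots> \<le> L * (10 * (L * P))" using LP L by (intro mult_left_mono) auto
  finally have "L * (?e13 + ?e23 + (L * r * (\<alpha>\<^sup>2 * \<beta>\<^sup>2) + ?e13) / r) \<le> L * (L * (10 * (L * P)))"
    using L by (intro mult_left_mono) auto
  then show ?thesis using main unfolding P_def by (simp add: eval_nat_numeral mult_ac)
qed

text \<open>Coordinates are sorted into dyadic levels. Level \<open>a\<close> has values at most
  \<open>2 ^ (- a)\<close> and, as the norm is 1, at most \<open>4 ^ (a + 1)\<close> vertices. For
  levels \<open>a\<close>, \<open>b\<close>, \<open>c\<close> the bound of
  \<open>card_triangles\<close> matches the weight \<open>2 ^ (- a - b - 2 * c)\<close> up to the
  factor 16, so each of the \<open>(A + 1) ^ 3\<close> triples of levels contributes at most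
  \<open>160 * L ^ 3\<close>.\<close>

lemma sorted_triangles_sum:
  fixes x :: "nat \<Rightarrow> real"
  assumes x0: "\<And>i. 0 \<le> x i" and norm: "(\<Sum>i<n. (x i)\<^sup>2) = 1" and A: "n \<le> 4 ^ (A + 1)"
  shows "(\<Sum>(i, j, k) | (i, j, k) \<in> triangles {..<n} {..<n} {..<n} \<and> x j \<le> x i \<and> x k \<le> x j.
            x i * x j * (x k)\<^sup>2) \<le> 160 * L ^ 3 * (real A + 1) ^ 3"
proof -
  let ?h = "\<lambda>a. (1 / 2 :: real) ^ a"
  \<comment> \<open>The alternative \<open>A \<le> a\<close> caps the levels: level \<open>A\<close>
    also collects all smaller coordinates, including zeros, and its size is controlled by
    \<open>n \<le> 4 ^ (A + 1)\<close> instead of the norm.\<close>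
  define lev where "lev i = (LEAST a. A \<le> a \<or> ?h (a + 1) \<le> x i)" for i
  define S where "S a = {i \<in> {..<n}. lev i = a}" for a
  have lev: "A \<le> lev i \<or> ?h (lev i + 1) \<le> x i" for i
    unfolding lev_def by (rule LeastI[of _ A]) simp
  have lev_le: "lev i \<le> A" for i unfolding lev_def by (rule Least_le) simp
  have lev_mono: "lev i \<le> lev j" if "x j \<le> x i" for i j
    unfolding lev_def[of i] by (rule Least_le) (use lev[of j] that in auto)
  have x_le: "x i \<le> ?h (lev i)" if "i < n" for i
  proof (cases "lev i")
    case 0
    have "(x i)\<^sup>2 \<le> (\<Sum>i<n. (x i)\<^sup>2)" using that by (intro member_le_sum) auto
    then have "x i \<le> 1" using norm power2_le_imp_le[of "x i" 1] by simp
    then show ?thesis using 0 by simp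
  next
    case (Suc b)
    then have "\<not> (A \<le> b \<or> ?h (b + 1) \<le> x i)"
      unfolding lev_def by (intro not_less_Least) simp
    then show ?thesis using Suc by simp
  qed
  have card_S: "real (card (S a)) \<le> (2 ^ (a + 1))\<^sup>2" if "a \<le> A" for a
  proof (cases "a = A")
    case True
    have "card (S a) \<le> card {..<n}" unfolding S_def by (intro card_mono) auto
    then have "real (card (S a)) \<le> real (4 ^ (A + 1))"
      using A by (intro of_nat_mono) simp
    also have "\<dots> = (2 ^ (a + 1))\<^sup>2" using True power_mult[of "2::real" 2 "A + 1"] by (simp add: mult.commute flip: power_mult)
    finally show ?thesis .
  next
    case False
    have "real (card (S a)) * (?h (a + 1))\<^sup>2 = (\<Sum>i\<in>S a. (?h (a + 1))\<^sup>2)" by simp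
    also have "\<dots> \<le> (\<Sum>i\<in>S a. (x i)\<^sup>2)"
    proof (rule sum_mono)
      fix i assume "i \<in> S a"
      then have "?h (a + 1) \<le> x i" using lev[of i] False that unfolding S_def by auto
      then show "(?h (a + 1))\<^sup>2 \<le> (x i)\<^sup>2" by (intro power_mono) auto
    qed
    also have "\<dots> \<le> (\<Sum>i<n. (x i)\<^sup>2)" by (intro sum_mono2) (auto simp: S_def)
    finally show ?thesis using norm by (simp add: power_divide pos_divide_le_eq)
  qed
  define T where "T = {q \<in> triangles {..<n} {..<n} {..<n}. case q of (i, j, k) \<Rightarrow> x j \<le> x i \<and> x k \<le> x j}"
  define g where "g q = (case q of (i, j, k) \<Rightarrow> (lev i, lev j, lev k))" for q
  define w where "w q = (case q of (a, b, c) \<Rightarrow> ?h a * ?h b * (?h c)\<^sup>2)" for q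
  have finT: "finite T" unfolding T_def by (simp add: finite_triangles)
  have T_eq: "{(i, j, k). (i, j, k) \<in> triangles {..<n} {..<n} {..<n} \<and> x j \<le> x i \<and> x k \<le> x j} = T"
    unfolding T_def by auto
  have "(\<Sum>(i, j, k)\<in>T. x i * x j * (x k)\<^sup>2) \<le> (\<Sum>q\<in>T. w (g q))"
  proof (rule sum_mono)
    fix q assume q: "q \<in> T"
    obtain i j k where ijk: "q = (i, j, k)" by (cases q)
    then have "i < n" "j < n" "k < n" using q by (auto simp: T_def triangles_def)
    then have "x i * x j * (x k)\<^sup>2 \<le> ?h (lev i) * ?h (lev j) * (?h (lev k))\<^sup>2"
      using x_le x0 by (intro mult_mono power_mono) auto
    then show "(case q of (i, j, k) \<Rightarrow> x i * x j * (x k)\<^sup>2) \<le> w (g q)"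
      by (simp add: ijk g_def w_def)
  qed
  also have "\<dots> = (\<Sum>p\<in>{..A} \<times> {..A} \<times> {..A}. \<Sum>q\<in>{q \<in> T. g q = p}. w (g q))"
    by (rule sum.group[symmetric]) (use finT lev_le in \<open>auto simp: g_def\<close>)
  also have "\<dots> \<le> (\<Sum>p\<in>{..A} \<times> {..A} \<times> {..A}. 160 * L ^ 3)"
  proof (rule sum_mono)
    fix p assume p: "p \<in> {..A} \<times> {..A} \<times> {..A}"
    obtain a b c where abc: "p = (a, b, c)" by (cases p)
    have "(\<Sum>q\<in>{q \<in> T. g q = p}. w (g q)) = (\<Sum>q\<in>{q \<in> T. g q = p}. w p)" by (intro sum.cong) auto
    then have eq: "(\<Sum>q\<in>{q \<in> T. g q = p}. w (g q)) = real (card {q \<in> T. g q = p}) * w p" by simp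
    show "(\<Sum>q\<in>{q \<in> T. g q = p}. w (g q)) \<le> 160 * L ^ 3"
    proof (cases "a \<le> b \<and> b \<le> c")
      case True
      have "{q \<in> T. g q = p} \<subseteq> triangles (S a) (S b) (S c)"
        unfolding T_def triangles_def g_def S_def abc by auto
      then have "card {q \<in> T. g q = p} \<le> card (triangles (S a) (S b) (S c))"
        by (intro card_mono finite_triangles) (auto simp: S_def)
      then have "real (card {q \<in> T. g q = p}) \<le> real (card (triangles (S a) (S b) (S c)))" by simp
      also have "\<dots> \<le> 10 * L ^ 3 * (2 ^ (a + 1) * 2 ^ (b + 1) * (2 ^ (c + 1))\<^sup>2)"
        using True p abc one_le_power[of "2::real" "a + 1"]
        by (intro card_triangles card_S) (auto simp: S_def power_increasing)
      finally have "real (card {q \<in> T. g q = p}) * w p \<le> 10 * L ^ 3 * (2 ^ (a + 1) * 2 ^ (b + 1) * (2 ^ (c + 1))\<^sup>2) * w p"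
        by (intro mult_right_mono) (auto simp: w_def abc)
      also have "\<dots> = 160 * L ^ 3" by (simp add: w_def abc power_divide power2_eq_square)
      finally show ?thesis using eq by simp
    next
      case False
      \<comment> \<open>Decreasing coordinates have nondecreasing levels, so triples of levels in
        any other order are empty.\<close>
      have "{q \<in> T. g q = p} = {}"
        using False lev_mono unfolding T_def g_def abc by force
      then have "real (card {q \<in> T. g q = p}) = 0" by (metis card.empty of_nat_0)
      then show ?thesis using eq L by simp
    qed
  qed
  also have "\<dots> = 160 * L ^ 3 * (real A + 1) ^ 3"
    by (simp add: card_cartesian_product power3_eq_cube algebra_simps)
  finally show ?thesis unfolding T_eq .
qed

lemma four_clique_sorted:
  fixes x :: "nat \<Rightarrow> real"
  assumes "K \<in> four_cliques n E"
  obtains i j k l where "K = {i, j, k, l}" "(i, j, k) \<in> triangles {..<n} {..<n} {..<n}"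
    "l \<in> common_nbrs n E {i, j, k}" "x j \<le> x i" "x k \<le> x j" "x l \<le> x k"
proof -
  have K: "finite K" "card K = 4" "K \<subseteq> {..<n}" "nsets K 2 \<subseteq> E"
    using assms by (simp_all add: four_cliques_def nsets_def[of _ 4])
  define xs where "xs = sort_key (\<lambda>i. - x i) (sorted_list_of_set K)"
  have "length xs = 4" "set xs = K" "distinct xs" "sorted (map (\<lambda>i. - x i) xs)"
    using K by (simp_all add: xs_def)
  moreover from this obtain i j k l where "xs = [i, j, k, l]"
    by (auto simp: eval_nat_numeral length_Suc_conv)
  ultimately have ijkl: "K = {i, j, k, l}" "distinct [i, j, k, l]" "x j \<le> x i" "x k \<le> x j" "x l \<le> x k"
    by auto
  have edge: "{u, v} \<in> E" if "u \<in> K" "v \<in> K" "u \<noteq> v" for u v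
    using K(4) that doubleton_in_nsets_2[of u v K] by blast
  show ?thesis
  proof (rule that[OF ijkl(1) _ _ ijkl(3-5)])
    show "(i, j, k) \<in> triangles {..<n} {..<n} {..<n}"
      using ijkl(1,2) K(3) unfolding triangles_def by (auto intro!: edge)
    show "l \<in> common_nbrs n E {i, j, k}"
      using ijkl(1,2) K(3) unfolding common_nbrs_def by (auto intro!: edge)
  qed
qed

lemma clique_poly_le:
  fixes x :: "nat \<Rightarrow> real"
  assumes x0: "\<And>i. 0 \<le> x i" and norm: "(\<Sum>i<n. (x i)\<^sup>2) = 1" and A: "n \<le> 4 ^ (A + 1)"
  shows "clique_poly n E x \<le> 160 * L ^ 4 * (real A + 1) ^ 3"
proof -
  define T where "T = {(i, j, k). (i, j, k) \<in> triangles {..<n} {..<n} {..<n} \<and> x j \<le> x i \<and> x k \<le> x j}"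
  define N where "N q = (case q of (i, j, k) \<Rightarrow> {l \<in> common_nbrs n E {i, j, k}. x l \<le> x k})" for q
  define s where "s = (\<lambda>((i, j, k), l). {i, j, k, l :: nat})"
  have finT: "finite T"
    by (rule finite_subset[OF _ finite_triangles[of "{..<n}" "{..<n}" "{..<n}"]]) (auto simp: T_def)
  have finN: "finite (N q)" for q
    unfolding N_def by (cases q) (auto simp: finite_common_nbrs)
  have "clique_poly n E x \<le> (\<Sum>K\<in>s ` (SIGMA q:T. N q). \<Prod>i\<in>K. x i)"
    unfolding clique_poly_def
  proof (rule sum_mono2)
    show "finite (s ` (SIGMA q:T. N q))" using finT finN by blast
    show "four_cliques n E \<subseteq> s ` (SIGMA q:T. N q)"
    proof
      fix K assume "K \<in> four_cliques n E"
      then obtain i j k l where "K = {i, j, k, l}" "(i, j, k) \<in> triangles {..<n} {..<n} {..<n}"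
        "l \<in> common_nbrs n E {i, j, k}" "x j \<le> x i" "x k \<le> x j" "x l \<le> x k"
        by (rule four_clique_sorted)
      then show "K \<in> s ` (SIGMA q:T. N q)"
        by (intro image_eqI[of _ _ "((i, j, k), l)"]) (auto simp: s_def T_def N_def)
    qed
  qed (auto intro: prod_nonneg x0)
  \<comment> \<open>Ties may give a clique several sorted orders; as all terms are nonnegative,
    counting it repeatedly is harmless.\<close>
  also have "\<dots> \<le> (\<Sum>p\<in>(SIGMA q:T. N q). \<Prod>i\<in>s p. x i)"
    using sum_image_le[of "SIGMA q:T. N q" "\<lambda>K. \<Prod>i\<in>K. x i" s] finT finN x0
    by (simp add: prod_nonneg comp_def)
  also have "\<dots> = (\<Sum>q\<in>T. \<Sum>l\<in>N q. \<Prod>i\<in>s (q, l). x i)"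
    using finT finN by (simp add: sum.Sigma split_beta)
  also have "\<dots> \<le> (\<Sum>q\<in>T. L * (case q of (i, j, k) \<Rightarrow> x i * x j * (x k)\<^sup>2))"
  proof (rule sum_mono)
    fix q assume q: "q \<in> T"
    obtain i j k where ijk: "q = (i, j, k)" by (cases q)
    have tri: "{i, j} \<in> E" "{i, k} \<in> E" "{j, k} \<in> E" using q by (auto simp: T_def triangles_def ijk)
    note ne = edge_vertices[OF tri(1)] edge_vertices[OF tri(2)] edge_vertices[OF tri(3)]
    have "(\<Sum>l\<in>N q. \<Prod>i\<in>s (q, l). x i) \<le> (\<Sum>l\<in>N q. x i * x j * (x k)\<^sup>2)"
    proof (rule sum_mono)
      fix l assume l: "l \<in> N q"
      then have "{i, l} \<in> E" "{j, l} \<in> E" "{k, l} \<in> E" "x l \<le> x k"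
        by (auto simp: N_def ijk common_nbrs_def)
      then have "i \<noteq> l" "j \<noteq> l" "k \<noteq> l" "x l \<le> x k" using edge_vertices(3) by blast+
      then have "(\<Prod>i\<in>s (q, l). x i) = x i * x j * x k * x l"
        using ne by (simp add: s_def ijk mult_ac)
      also have "\<dots> \<le> x i * x j * x k * x k" using \<open>x l \<le> x k\<close> x0 by (intro mult_left_mono) auto
      finally show "(\<Prod>i\<in>s (q, l). x i) \<le> x i * x j * (x k)\<^sup>2" by (simp add: power2_eq_square mult_ac)
    qed
    also have "\<dots> = real (card (N q)) * (x i * x j * (x k)\<^sup>2)" by simp
    \<comment> \<open>The three vertices are distinct, so the codegree bound is
      \<open>L * r ^ 0\<close>.\<close>
    also have "\<dots> \<le> L * (x i * x j * (x k)\<^sup>2)"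
    proof (rule mult_right_mono)
      have "card (N q) \<le> card (common_nbrs n E {i, j, k})"
        by (intro card_mono finite_common_nbrs) (auto simp: N_def ijk)
      moreover have "real (card (common_nbrs n E {i, j, k})) \<le> L * r ^ (3 - card {i, j, k})"
        using ne by (intro card_common_nbrs) auto
      ultimately show "real (card (N q)) \<le> L" using ne by simp
    qed (use x0 in auto)
    finally show "(\<Sum>l\<in>N q. \<Prod>i\<in>s (q, l). x i) \<le> L * (case q of (i, j, k) \<Rightarrow> x i * x j * (x k)\<^sup>2)"
      by (simp add: ijk)
  qed
  also have "\<dots> = L * (\<Sum>(i, j, k)\<in>T. x i * x j * (x k)\<^sup>2)" by (simp add: sum_distrib_left)
  also have "\<dots> \<le> L * (160 * L ^ 3 * (real A + 1) ^ 3)"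
    unfolding T_def using L by (intro mult_left_mono sorted_triangles_sum assms) auto
  finally show ?thesis by (simp add: eval_nat_numeral mult_ac)
qed

lemma abs_clique_poly_le:
  fixes x :: "nat \<Rightarrow> real"
  assumes "L2_set x {..<n} = 1" "n \<le> 4 ^ (A + 1)"
  shows "\<bar>clique_poly n E x\<bar> \<le> 160 * L ^ 4 * (real A + 1) ^ 3"
proof -
  have "\<bar>clique_poly n E x\<bar> \<le> clique_poly n E (\<lambda>i. \<bar>x i\<bar>)"
    unfolding clique_poly_def by (rule order_trans[OF sum_abs]) (simp add: abs_prod)
  also have "\<dots> \<le> 160 * L ^ 4 * (real A + 1) ^ 3"
    using assms by (intro clique_poly_le) (auto simp: L2_set_def)
  finally show ?thesis .
qed

text \<open>The expansion of \<open>f^m\<close> has at least \<open>(r ^ 6 / 1000) ^ m\<close>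
  terms, against \<open>(5 * L ^ 4 * r ^ 5) ^ m\<close> rows up to factorials; the quotient is
  \<open>(r / (5000 * L ^ 4)) ^ m\<close>. The square root appears because
  \<open>card_le_spectral_norm\<close> bounds the square of the norm.\<close>

lemma ratio_ge:
  assumes A: "n \<le> 4 ^ (A + 1)" and N: "real (card (four_cliques n E)) \<ge> r ^ 6 / 1000"
  shows "sp_norm n (4 * m) (\<lambda>x. clique_poly n E x ^ m) / two_norm n (\<lambda>x. clique_poly n E x ^ m)
    \<ge> sqrt ((r / (5000 * L ^ 4)) ^ m / (fact (2 * m) * fact (4 * m))) / (160 * L ^ 4 * (real A + 1) ^ 3) ^ m"
proof -
  define B where "B = 160 * L ^ 4 * (real A + 1) ^ 3"
  define T where "T = {Ks. set Ks \<subseteq> four_cliques n E \<and> length Ks = m}"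
  define h where "h = (\<lambda>x. clique_poly n E x ^ m)"
  define l where "l = sqrt ((r / (5000 * L ^ 4)) ^ m / (fact (2 * m) * fact (4 * m)))"
  have "n > 0" using r by (metis gr0I not_one_le_zero of_nat_0 power_eq_0_iff)
  have fin: "finite (four_cliques n E)" unfolding four_cliques_eq by (rule finite_cliques)
  have finT: "finite T" and cardT: "card T = card (four_cliques n E) ^ m"
    unfolding T_def using fin by (auto intro: finite_lists_length_eq simp: card_lists_length_eq)
  have nsets4: "set Ks \<subseteq> nsets {..<n} 4" "length Ks = m" if "Ks \<in> T" for Ks
    using that by (auto simp: T_def four_cliques_def)
  have h: "h = (\<lambda>x. \<Sum>Ks\<in>T. \<Prod>i\<in>#clique_mset Ks. x i)"
  proof
    fix x
    have "h x = (\<Sum>Ks\<in>T. \<Prod>K\<leftarrow>Ks. \<Prod>i\<in>K. x i)"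
      unfolding h_def clique_poly_def T_def by (rule sum_power_lists[OF fin])
    also have "\<dots> = (\<Sum>Ks\<in>T. \<Prod>i\<in>#clique_mset Ks. x i)"
      using nsets4 by (intro sum.cong prod_list_clique_mset) (auto simp: nsets_def)
    finally show "h x = (\<Sum>Ks\<in>T. \<Prod>i\<in>#clique_mset Ks. x i)" .
  qed
  have lower: "l \<le> spectral_norm (tuples n (2 * m)) M" if M: "represents n (4 * m) M h" for M
  proof -
    define s where "s = spectral_norm (tuples n (2 * m)) M"
    have "replicate (2 * m) 0 \<in> tuples n (2 * m)" using \<open>n > 0\<close> by (auto simp: tuples_def)
    then have s0: "s \<ge> 0" unfolding s_def by (intro spectral_norm_nonneg finite_tuples) auto
    have "represents n (2 * (2 * m)) M (\<lambda>x. \<Sum>Ks\<in>T. \<Prod>i\<in>#clique_mset Ks. x i)"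
      using M h by simp
    then have "real (card T) \<le> s\<^sup>2 * (real (card (clique_rows m)) * fact (2 * (2 * m)))"
      unfolding s_def
    proof (rule card_le_spectral_norm[OF finT \<open>n > 0\<close>])
      show "finite (clique_rows m)"
        by (rule finite_subset[OF _ finite_tuples[of n "2 * m"]]) (auto simp: clique_rows_def)
      fix I J Ks assume IJ: "I \<in> tuples n (2 * m)" "J \<in> tuples n (2 * m)" "Ks \<in> T" "mset (I @ J) = clique_mset Ks"
      have "mset J \<subseteq># clique_mset Ks" by (simp flip: IJ(4))
      then show "J \<in> clique_rows m" using IJ by (auto simp: clique_rows_def T_def)
    qed
    also have "\<dots> \<le> s\<^sup>2 * ((fact (2 * m) * (5 * L ^ 4 * r ^ 5) ^ m) * fact (4 * m))"
      using L r by (intro mult_left_mono mult_mono card_clique_rows) auto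
    finally have 1: "real (card T) \<le> s\<^sup>2 * (fact (2 * m) * fact (4 * m)) * (5 * L ^ 4 * r ^ 5) ^ m"
      by (simp add: mult_ac)
    have "(r / (5000 * L ^ 4)) ^ m * (5 * L ^ 4 * r ^ 5) ^ m = (r ^ 6 / 1000) ^ m"
      using L r by (simp add: power_mult_distrib[symmetric] eval_nat_numeral)
    also have "\<dots> \<le> real (card T)"
      unfolding cardT of_nat_power using N r by (intro power_mono) auto
    also note 1
    finally have "(r / (5000 * L ^ 4)) ^ m \<le> s\<^sup>2 * (fact (2 * m) * fact (4 * m))"
      using L r by (simp add: mult_le_cancel_right)
    then have "(r / (5000 * L ^ 4)) ^ m / (fact (2 * m) * fact (4 * m)) \<le> s\<^sup>2"
      by (subst pos_divide_le_eq) auto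
    then have "l \<le> sqrt (s\<^sup>2)" unfolding l_def by (rule real_sqrt_le_mono)
    then show ?thesis using s0 by (simp add: s_def)
  qed
  have sp: "l \<le> sp_norm n (4 * m) h"
    unfolding sp_norm_def
  proof (rule cInf_greatest)
    have "size (clique_mset Ks) = 2 * (2 * m) \<and> set_mset (clique_mset Ks) \<subseteq> {..<n}" if "Ks \<in> T" for Ks
      using set_size_clique_mset[OF nsets4(1)[OF that]] nsets4(2)[OF that] by simp
    then have "\<exists>M. symmetric_matrix (tuples n (2 * m)) M \<and> represents n (2 * (2 * m)) M (\<lambda>x. \<Sum>Ks\<in>T. \<Prod>i\<in>#clique_mset Ks. x i)"
      by (rule symmetric_representation_exists[OF finT])
    then show "{spectral_norm (tuples n (4 * m div 2)) M |M. symmetric_matrix (tuples n (4 * m div 2)) M \<and> represents n (4 * m) M h} \<noteq> {}"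
      unfolding h by simp
  qed (use lower in auto)
  have abs_h: "\<bar>h x\<bar> \<le> B ^ m" if "x \<in> {x. L2_set x {..<n} = 1}" for x
    unfolding h_def B_def power_abs using that A by (intro power_mono abs_clique_poly_le) auto
  then have bdd: "bdd_above ((\<lambda>x. \<bar>h x\<bar>) ` {x. L2_set x {..<n} = 1})" by (rule bdd_aboveI2)
  \<comment> \<open>The constant unit vector shows that the denominator is positive and that the
    supremum is over a nonempty set.\<close>
  define x where "x = (\<lambda>i::nat. 1 / sqrt (real n))"
  have x: "x \<in> {x. L2_set x {..<n} = 1}" using \<open>n > 0\<close> by (simp add: x_def L2_set_def power_divide)
  have "four_cliques n E \<noteq> {}" using N r by auto
  then have "clique_poly n E x > 0"
    unfolding clique_poly_def using fin \<open>n > 0\<close> by (intro sum_pos prod_pos) (auto simp: x_def)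
  then have "0 < \<bar>h x\<bar>" by (simp add: h_def)
  also have "\<dots> \<le> two_norm n h" unfolding two_norm_def by (rule cSUP_upper[OF x bdd])
  finally have two_pos: "0 < two_norm n h" .
  have two_le: "two_norm n h \<le> B ^ m"
    unfolding two_norm_def using x abs_h by (intro cSUP_least) auto
  have "l \<ge> 0" unfolding l_def using L r by simp
  then have "l / B ^ m \<le> l / two_norm n h"
    using two_le two_pos by (intro divide_left_mono) auto
  also have "\<dots> \<le> sp_norm n (4 * m) h / two_norm n h"
    using sp two_pos by (intro divide_right_mono) auto
  finally show ?thesis unfolding h_def l_def B_def .
qed

end

subsection \<open>Random graphs\<close>

lemma set_pmf_gnp: "E \<in> set_pmf (gnp n p) \<Longrightarrow> E \<subseteq> nsets {..<n} 2"
  by (auto simp: gnp_def)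

lemma finite_set_pmf_gnp: "finite (set_pmf (gnp n p))"
  by (rule finite_subset[of _ "Pow (nsets {..<n} 2)"])
    (auto dest: set_pmf_gnp intro: finite_imp_finite_nsets)

lemma prob_gnp_superset:
  assumes "0 \<le> p" "p \<le> 1" "F \<subseteq> nsets {..<n} 2"
  shows "measure_pmf.prob (gnp n p) {E. F \<subseteq> E} = p ^ card F"
proof -
  let ?V = "nsets {..<n} 2"
  have fin: "finite ?V" by (simp add: finite_imp_finite_nsets)
  \<comment> \<open>As a product set over the potential edges, the event has probability equal to
    the product over the independent coordinates.\<close>
  have eq: "(\<lambda>b. {e \<in> ?V. b e}) -` {E. F \<subseteq> E} = Pi ?V (\<lambda>e. if e \<in> F then {True} else UNIV)"
  proof (intro set_eqI iffI)
    fix b assume "b \<in> (\<lambda>b. {e \<in> ?V. b e}) -` {E. F \<subseteq> E}"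
    then show "b \<in> Pi ?V (\<lambda>e. if e \<in> F then {True} else UNIV)" by auto
  next
    fix b assume b: "b \<in> Pi ?V (\<lambda>e. if e \<in> F then {True} else UNIV)"
    have "b e" if "e \<in> F" for e using b that assms(3) by (auto dest: Pi_mem[of b _ _ e])
    then show "b \<in> (\<lambda>b. {e \<in> ?V. b e}) -` {E. F \<subseteq> E}" using assms(3) by auto
  qed
  have "measure_pmf.prob (gnp n p) {E. F \<subseteq> E} = (\<Prod>e\<in>?V. if e \<in> F then p else 1)"
    unfolding gnp_def measure_map_pmf eq measure_Pi_pmf_Pi[OF fin]
    using assms(1,2) by (intro prod.cong) (auto simp: measure_pmf_single)
  also have "\<dots> = p ^ card F"
    using fin assms(3) by (simp add: prod.If_cases Int_absorb1)
  finally show ?thesis .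
qed

lemma power_div_fact_le_exp:
  fixes x :: real
  assumes "0 \<le> x"
  shows "x ^ t / fact t \<le> exp x"
proof -
  have "(\<lambda>n. x ^ n / fact n) sums exp x"
    using exp_converges[of x] by (simp add: divide_inverse_commute)
  then show ?thesis
    using sum_le_suminf[of "\<lambda>n. x ^ n / fact n" "{t}"] assms by (simp add: sums_iff)
qed

text \<open>
  A union bound over the \<open>t\<close>-element subfamilies gives the bound \<open>\<mu> ^ t / t!\<close>, where \<open>\<mu>\<close> is
  the expected number of sets contained in the edge set.
\<close>

lemma prob_gnp_many_subsets:
  assumes p: "0 \<le> p" "p \<le> 1" and fin: "finite W"
    and F: "\<And>w. w \<in> W \<Longrightarrow> F w \<subseteq> nsets {..<n} 2"
    and card_F: "\<And>T. T \<subseteq> W \<Longrightarrow> card (\<Union>w\<in>T. F w) = k * card T"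
  shows "measure_pmf.prob (gnp n p) {E. \<tau> < real (card {w \<in> W. F w \<subseteq> E})} \<le> exp (3 * (real (card W) * p ^ k) - \<tau>)"
\<comment> \<open>For negative \<open>\<tau>\<close> the claimed bound is at least 1.\<close>
proof (cases "\<tau> < 0")
  case True
  moreover have "0 \<le> real (card W) * p ^ k" using p by simp
  ultimately have "1 \<le> exp (3 * (real (card W) * p ^ k) - \<tau>)" unfolding one_le_exp_iff by linarith
  then show ?thesis using measure_pmf.prob_le_1 order_trans by blast
next
  case False
  define \<mu> where "\<mu> = real (card W) * p ^ k"
  \<comment> \<open>The least natural number strictly above \<open>\<tau>\<close>.\<close>
  define t where "t = nat \<lfloor>\<tau>\<rfloor> + 1"
  have \<mu>0: "\<mu> \<ge> 0" using p by (simp add: \<mu>_def)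
  have t: "\<tau> \<le> real t" "\<And>j. \<tau> < real j \<Longrightarrow> t \<le> j"
    using False unfolding t_def by linarith+
  have "{E. \<tau> < real (card {w \<in> W. F w \<subseteq> E})} \<subseteq> (\<Union>T\<in>nsets W t. {E. (\<Union>w\<in>T. F w) \<subseteq> E})"
  proof
    fix E assume "E \<in> {E. \<tau> < real (card {w \<in> W. F w \<subseteq> E})}"
    then have "t \<le> card {w \<in> W. F w \<subseteq> E}" using t(2) by simp
    then obtain T where "T \<subseteq> {w \<in> W. F w \<subseteq> E}" "card T = t" "finite T"
      by (rule obtain_subset_with_card_n)
    then show "E \<in> (\<Union>T\<in>nsets W t. {E. (\<Union>w\<in>T. F w) \<subseteq> E})"
      by (intro UN_I[of T]) (auto simp: nsets_def)
  qed
  then have "measure_pmf.prob (gnp n p) {E. \<tau> < real (card {w \<in> W. F w \<subseteq> E})}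
      \<le> measure_pmf.prob (gnp n p) (\<Union>T\<in>nsets W t. {E. (\<Union>w\<in>T. F w) \<subseteq> E})"
    by (intro measure_pmf.finite_measure_mono) auto
  also have "\<dots> \<le> (\<Sum>T\<in>nsets W t. measure_pmf.prob (gnp n p) {E. (\<Union>w\<in>T. F w) \<subseteq> E})"
    by (intro measure_pmf.finite_measure_subadditive_finite) (auto intro: finite_imp_finite_nsets fin)
  also have "\<dots> = (\<Sum>T\<in>nsets W t. p ^ (k * t))"
  proof (rule sum.cong[OF refl])
    fix T assume "T \<in> nsets W t"
    then have T: "T \<subseteq> W" "card T = t" by (auto simp: nsets_def)
    have "(\<Union>w\<in>T. F w) \<subseteq> nsets {..<n} 2" using T(1) F by blast
    from prob_gnp_superset[OF p this] show "measure_pmf.prob (gnp n p) {E. (\<Union>w\<in>T. F w) \<subseteq> E} = p ^ (k * t)"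
      unfolding card_F[OF T(1)] T(2) .
  qed
  also have "\<dots> = real (card W choose t) * (p ^ k) ^ t" by (simp add: power_mult)
  also have "\<dots> \<le> (real (card W) ^ t / fact t) * (p ^ k) ^ t"
  proof (rule mult_right_mono)
    have "real ((card W choose t) * fact t) \<le> real (card W ^ t)"
      using binomial_fact_pow of_nat_mono by blast
    then show "real (card W choose t) \<le> real (card W) ^ t / fact t" by (simp add: pos_le_divide_eq)
  qed (use p in auto)
  also have "\<dots> = \<mu> ^ t / fact t" by (simp add: \<mu>_def power_mult_distrib)
  \<comment> \<open>Inserting \<open>exp t * exp (- t)\<close> extracts the decay in
    \<open>t\<close>; what is left is one term of the series of \<open>exp (exp 1 * \<mu>)\<close>.
    The constant 3 bounds \<open>exp 1\<close>.\<close>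
  also have "\<dots> = exp (- real t) * ((exp 1 * \<mu>) ^ t / fact t)"
    using exp_of_nat_mult[of t "1 :: real"] by (simp add: power_mult_distrib exp_minus)
  also have "\<dots> \<le> exp (- real t) * exp (exp 1 * \<mu>)"
    using \<mu>0 by (intro mult_left_mono power_div_fact_le_exp) auto
  also have "\<dots> = exp (exp 1 * \<mu> - real t)" by (simp add: exp_add[symmetric])
  also have "\<dots> \<le> exp (3 * \<mu> - \<tau>)"
    using t(1) mult_right_mono[OF exp_le \<mu>0] by simp
  finally show ?thesis unfolding \<mu>_def .
qed

text \<open>The stars joining distinct vertices outside \<open>S\<close> to all of \<open>S\<close>
  are disjoint and have \<open>card S\<close> edges each, so \<open>prob_gnp_many_subsets\<close>
  applies. Vertices of \<open>S\<close> drop out because there are no loops.\<close>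

lemma prob_gnp_common_nbrs:
  assumes p: "0 \<le> p" "p \<le> 1" and S: "S \<subseteq> {..<n}"
  shows "measure_pmf.prob (gnp n p) {E. E \<subseteq> nsets {..<n} 2 \<and> \<tau> < real (card (common_nbrs n E S))}
    \<le> exp (3 * (real n * p ^ card S) - \<tau>)"
proof -
  define W where "W = {..<n} - S"
  define F where "F w = (\<lambda>u. {u, w}) ` S" for w
  have finS: "finite S" using S by (rule finite_subset) simp
  have F: "F w \<subseteq> nsets {..<n} 2" if "w \<in> W" for w
    using that S unfolding F_def W_def by auto
  have card_F: "card (\<Union>w\<in>T. F w) = card S * card T" if T: "T \<subseteq> W" for T
  proof -
    have "(\<Union>w\<in>T. F w) = (\<lambda>(u, w). {u, w}) ` (S \<times> T)" unfolding F_def by auto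
    moreover have "inj_on (\<lambda>(u, w). {u, w}) (S \<times> T)"
      using T unfolding W_def inj_on_def by (auto simp: doubleton_eq_iff)
    ultimately show ?thesis by (simp add: card_image card_cartesian_product)
  qed
  have "common_nbrs n E S \<subseteq> {w \<in> W. F w \<subseteq> E}" if E: "E \<subseteq> nsets {..<n} 2" for E
  proof
    fix w assume w: "w \<in> common_nbrs n E S"
    have "w \<notin> S"
    proof
      assume "w \<in> S"
      then have "{w, w} \<in> nsets {..<n} 2" using w E unfolding common_nbrs_def by blast
      then show False unfolding doubleton_in_nsets_2 by simp
    qed
    then show "w \<in> {w \<in> W. F w \<subseteq> E}" using w unfolding common_nbrs_def W_def F_def by auto
  qed
  then have "card (common_nbrs n E S) \<le> card {w \<in> W. F w \<subseteq> E}" if "E \<subseteq> nsets {..<n} 2" for E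
    using that by (intro card_mono) (auto simp: W_def)
  then have "{E. E \<subseteq> nsets {..<n} 2 \<and> \<tau> < real (card (common_nbrs n E S))} \<subseteq> {E. \<tau> < real (card {w \<in> W. F w \<subseteq> E})}"
    by (auto intro: less_le_trans)
  then have "measure_pmf.prob (gnp n p) {E. E \<subseteq> nsets {..<n} 2 \<and> \<tau> < real (card (common_nbrs n E S))}
      \<le> measure_pmf.prob (gnp n p) {E. \<tau> < real (card {w \<in> W. F w \<subseteq> E})}"
    by (intro measure_pmf.finite_measure_mono) auto
  also have "\<dots> \<le> exp (3 * (real (card W) * p ^ card S) - \<tau>)"
    by (rule prob_gnp_many_subsets[OF p _ F card_F]) (auto simp: W_def)
  also have "card W \<le> card {..<n}" unfolding W_def by (intro card_mono) auto
  then have "exp (3 * (real (card W) * p ^ card S) - \<tau>) \<le> exp (3 * (real n * p ^ card S) - \<tau>)"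
    using p by (simp add: mult_right_mono)
  finally show ?thesis .
qed

text \<open>An edge comes from at most two ordered pairs. Writing membership as
  \<open>{e} \<subseteq> E\<close> fits \<open>prob_gnp_many_subsets\<close> with
  singletons.\<close>

lemma card_edge_pairs_le:
  assumes E: "E \<subseteq> nsets {..<n} 2" and fin: "finite A" "finite B"
  shows "card (edge_pairs E A B) \<le> 2 * card {e \<in> (\<lambda>(u, v). {u, v}) ` (A \<times> B) \<inter> nsets {..<n} 2. {e} \<subseteq> E}"
proof -
  define W where "W = {e \<in> (\<lambda>(u, v). {u, v}) ` (A \<times> B) \<inter> nsets {..<n} 2. {e} \<subseteq> E}"
  define G where "G e = {(u, v). {u, v} = e}" for e :: "nat set"
  have finW: "finite W" unfolding W_def using fin by (intro finite_Collect_conjI disjI1) simp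
  have G: "finite (G e)" "card (G e) \<le> 2" if "e \<in> W" for e
  proof -
    have "e \<in> (\<lambda>(u, v). {u, v}) ` (A \<times> B)" using that unfolding W_def by blast
    then obtain q where "e = (\<lambda>(u, v). {u, v}) q" by blast
    then obtain a b where e: "e = {a, b}" by (cases q) simp
    have sub: "G e \<subseteq> {(a, b), (b, a)}"
    proof (rule subsetI)
      fix q assume "q \<in> G e"
      moreover obtain u v where q: "q = (u, v)" by (cases q)
      ultimately have "{u, v} = {a, b}" by (simp only: G_def e mem_Collect_eq case_prod_conv)
      then show "q \<in> {(a, b), (b, a)}" unfolding doubleton_eq_iff q by blast
    qed
    then show "finite (G e)" by (rule finite_subset) simp
    have "card (G e) \<le> card {(a, b), (b, a)}" by (rule card_mono[OF _ sub]) simp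
    also have "\<dots> \<le> 2" by (cases "a = b") simp_all
    finally show "card (G e) \<le> 2" .
  qed
  have "edge_pairs E A B \<subseteq> (\<Union>e\<in>W. G e)"
  proof clarify
    fix u v assume uv: "(u, v) \<in> edge_pairs E A B"
    have "{u, v} \<in> (\<lambda>(u, v). {u, v}) ` (A \<times> B)"
      by (rule image_eqI[of _ _ "(u, v)"]) (use uv in \<open>simp_all add: edge_pairs_def\<close>)
    moreover have uvE: "{u, v} \<in> E" using uv by (simp add: edge_pairs_def)
    moreover have "{u, v} \<in> nsets {..<n} 2" using E uvE by (rule subsetD)
    ultimately have "{u, v} \<in> W"
      unfolding W_def by (intro CollectI conjI IntI) (assumption, assumption, simp only: insert_subset, simp)
    then show "(u, v) \<in> (\<Union>e\<in>W. G e)" by (rule UN_I) (simp add: G_def)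
  qed
  then have "card (edge_pairs E A B) \<le> card (\<Union>e\<in>W. G e)"
    by (intro card_mono finite_UN_I[OF finW] G(1))
  also have "\<dots> \<le> (\<Sum>e\<in>W. card (G e))" by (rule card_UN_le[OF finW])
  also have "\<dots> \<le> (\<Sum>e\<in>W. 2)" by (rule sum_mono) (rule G(2))
  finally have "card (edge_pairs E A B) \<le> 2 * card W" by simp
  then show ?thesis unfolding W_def .
qed

lemma prob_gnp_edge_pairs:
  assumes p: "0 \<le> p" "p \<le> 1" and fin: "finite A" "finite B"
  shows "measure_pmf.prob (gnp n p) {E. E \<subseteq> nsets {..<n} 2 \<and> 2 * \<tau> < real (card (edge_pairs E A B))}
    \<le> exp (3 * (real (card A) * real (card B) * p) - \<tau>)"
proof -
  let ?W = "(\<lambda>(u, v). {u, v}) ` (A \<times> B) \<inter> nsets {..<n} 2"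
  have "{E. E \<subseteq> nsets {..<n} 2 \<and> 2 * \<tau> < real (card (edge_pairs E A B))} \<subseteq> {E. \<tau> < real (card {e \<in> ?W. {e} \<subseteq> E})}"
  proof
    fix E assume E: "E \<in> {E. E \<subseteq> nsets {..<n} 2 \<and> 2 * \<tau> < real (card (edge_pairs E A B))}"
    then have "real (card (edge_pairs E A B)) \<le> real (2 * card {e \<in> ?W. {e} \<subseteq> E})"
      using card_edge_pairs_le[of E n A B] fin unfolding of_nat_le_iff by blast
    then show "E \<in> {E. \<tau> < real (card {e \<in> ?W. {e} \<subseteq> E})}" using E by simp
  qed
  then have "measure_pmf.prob (gnp n p) {E. E \<subseteq> nsets {..<n} 2 \<and> 2 * \<tau> < real (card (edge_pairs E A B))}
      \<le> measure_pmf.prob (gnp n p) {E. \<tau> < real (card {e \<in> ?W. {e} \<subseteq> E})}"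
    by (intro measure_pmf.finite_measure_mono) auto
  also have "\<dots> \<le> exp (3 * (real (card ?W) * p ^ 1) - \<tau>)"
    by (rule prob_gnp_many_subsets[OF p]) (use fin in auto)
  also have "card ?W \<le> card A * card B"
  proof -
    have "card ?W \<le> card ((\<lambda>(u, v). {u, v}) ` (A \<times> B))" using fin by (intro card_mono) auto
    also have "\<dots> \<le> card (A \<times> B)" using fin by (intro card_image_le) auto
    finally show ?thesis by (simp add: card_cartesian_product)
  qed
  then have "exp (3 * (real (card ?W) * p ^ 1) - \<tau>) \<le> exp (3 * (real (card A) * real (card B) * p) - \<tau>)"
  proof -
    assume "card ?W \<le> card A * card B"
    then have "real (card ?W) \<le> real (card A) * real (card B)" by (metis of_nat_mono of_nat_mult)
    then show ?thesis using mult_right_mono[OF _ p(1)] by simp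
  qed
  finally show ?thesis .
qed

section \<open>Second moment of the number of 4-cliques\<close>

lemma card_nsets_inter_le:
  assumes "K \<in> nsets {..<n} 4"
  shows "card {K' \<in> nsets {..<n} 4. card (K \<inter> K') = r} \<le> (4 choose r) * (n choose (4 - r))"
proof -
  have K: "finite K" "card K = 4" using assms by (auto simp: nsets_def)
  have "card {K' \<in> nsets {..<n} 4. card (K \<inter> K') = r} \<le> card (nsets K r \<times> nsets {..<n} (4 - r))"
  \<comment> \<open>For fixed \<open>K\<close>, the set \<open>K'\<close> is determined by its part
    inside \<open>K\<close> and its part outside.\<close>
  proof (rule card_inj_on_le[of "\<lambda>K'. (K \<inter> K', K' - K)"])
    show "inj_on (\<lambda>K'. (K \<inter> K', K' - K)) {K' \<in> nsets {..<n} 4. card (K \<inter> K') = r}"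
      by (rule inj_onI) (auto simp: set_eq_iff)
    show "(\<lambda>K'. (K \<inter> K', K' - K)) ` {K' \<in> nsets {..<n} 4. card (K \<inter> K') = r} \<subseteq> nsets K r \<times> nsets {..<n} (4 - r)"
    proof clarify
      fix K' assume K': "K' \<in> nsets {..<n} 4" "r = card (K \<inter> K')"
      then have "card (K' - K) = 4 - card (K \<inter> K')"
        using card_Diff_subset_Int[of K' K] K by (auto simp: nsets_def Int_commute)
      then show "K \<inter> K' \<in> nsets K (card (K \<inter> K')) \<and> K' - K \<in> nsets {..<n} (4 - card (K \<inter> K'))"
        using K K' by (auto simp: nsets_def)
    qed
    show "finite (nsets K r \<times> nsets {..<n} (4 - r))"
      using K by (simp add: finite_imp_finite_nsets)
  qed
  then show ?thesis using K by (simp add: card_cartesian_product)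
qed

text \<open>Each 4-set spans six pairs, and the shared pairs are those inside the
  intersection.\<close>

lemma card_nsets_2_Un:
  assumes "K \<in> nsets V 4" "K' \<in> nsets V 4"
  shows "card (nsets K 2 \<union> nsets K' 2) = 12 - (card (K \<inter> K') choose 2)"
proof -
  have K: "finite K" "card K = 4" "finite K'" "card K' = 4" using assms by (auto simp: nsets_def)
  have "nsets K 2 \<inter> nsets K' 2 = nsets (K \<inter> K') 2" by (auto simp: nsets_def)
  moreover have "card (nsets K 2 \<union> nsets K' 2) + card (nsets K 2 \<inter> nsets K' 2) = card (nsets K 2) + card (nsets K' 2)"
    using K by (intro card_Un_Int[symmetric]) (simp_all add: finite_imp_finite_nsets)
  moreover have "(4 choose 2 :: nat) = 6" by (simp add: eval_nat_numeral)
  ultimately show ?thesis using K by simp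
qed

lemma clique_count_eq_sum:
  "real (card (four_cliques n E)) = (\<Sum>K\<in>nsets {..<n} 4. indicator {E. nsets K 2 \<subseteq> E} E)"
proof -
  have "(\<Sum>K\<in>nsets {..<n} 4. indicator {E. nsets K 2 \<subseteq> E} E :: real) = (\<Sum>K\<in>nsets {..<n} 4. if nsets K 2 \<subseteq> E then 1 else 0)"
    by (intro sum.cong) (auto simp: indicator_def)
  also have "\<dots> = real (card (four_cliques n E))"
    by (simp add: sum.If_cases finite_imp_finite_nsets four_cliques_def Int_def)
  finally show ?thesis ..
qed

lemma expectation_clique_count:
  assumes p: "0 \<le> p" "p \<le> 1"
  shows "measure_pmf.expectation (gnp n p) (\<lambda>E. real (card (four_cliques n E))) = real (n choose 4) * p ^ 6"
proof -
  have "measure_pmf.expectation (gnp n p) (\<lambda>E. real (card (four_cliques n E)))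
      = (\<Sum>K\<in>nsets {..<n} 4. measure_pmf.prob (gnp n p) {E. nsets K 2 \<subseteq> E})"
    unfolding clique_count_eq_sum
    by (subst Bochner_Integration.integral_sum)
      (auto intro!: integrable_measure_pmf_finite finite_set_pmf_gnp)
  also have "\<dots> = (\<Sum>K\<in>nsets {..<n} 4. p ^ 6)"
  proof (rule sum.cong[OF refl])
    fix K assume K: "K \<in> nsets {..<n} 4"
    then have sub: "nsets K 2 \<subseteq> nsets {..<n} 2" by (intro nsets_mono) (auto simp: nsets_def)
    have "card K = 4" using K by (auto simp: nsets_def)
    moreover have "(4 choose 2 :: nat) = 6" by (simp add: eval_nat_numeral)
    ultimately show "measure_pmf.prob (gnp n p) {E. nsets K 2 \<subseteq> E} = p ^ 6"
      by (simp add: prob_gnp_superset[OF p sub])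
  qed
  finally show ?thesis by simp
qed

text \<open>Two 4-sets with fewer than two common vertices share no edge and contribute no
  covariance. With 2, 3 or 4 common vertices their union spans 11, 9 or 6 edges, and for fixed
  \<open>K\<close> there are at most \<open>6 * n ^ 2\<close>, \<open>4 * n\<close> and 1 such
  \<open>K'\<close>.\<close>

lemma variance_clique_count:
  assumes p: "0 \<le> p" "p \<le> 1"
  shows "measure_pmf.variance (gnp n p) (\<lambda>E. real (card (four_cliques n E)))
    \<le> real (n choose 4) * (6 * real n ^ 2 * p ^ 11 + 4 * real n * p ^ 9 + p ^ 6)"
proof -
  let ?V = "nsets {..<n} 4" and ?X = "\<lambda>E. real (card (four_cliques n E))"
  have int: "integrable (measure_pmf (gnp n p)) f" for f :: "nat set set \<Rightarrow> real"
    by (intro integrable_measure_pmf_finite finite_set_pmf_gnp)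
  have sub: "nsets K 2 \<subseteq> nsets {..<n} 2" if "K \<in> ?V" for K
    using that by (intro nsets_mono) (auto simp: nsets_def)
  define S where "S K K' = {E. nsets K 2 \<union> nsets K' 2 \<subseteq> E}" for K K' :: "nat set"
  have sq: "(?X E)\<^sup>2 = (\<Sum>K\<in>?V. \<Sum>K'\<in>?V. indicator (S K K') E)" for E
    unfolding clique_count_eq_sum power2_eq_square sum_product
    by (intro sum.cong) (auto simp: indicator_def S_def)
  have "measure_pmf.expectation (gnp n p) (\<lambda>E. (?X E)\<^sup>2)
      = (\<Sum>K\<in>?V. \<Sum>K'\<in>?V. measure_pmf.prob (gnp n p) (S K K'))"
    unfolding sq by (simp add: Bochner_Integration.integral_sum int)
  also have "\<dots> = (\<Sum>K\<in>?V. \<Sum>K'\<in>?V. p ^ (12 - (card (K \<inter> K') choose 2)))"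
  proof (intro sum.cong refl)
    fix K K' assume K: "K \<in> ?V" "K' \<in> ?V"
    have "measure_pmf.prob (gnp n p) (S K K') = p ^ card (nsets K 2 \<union> nsets K' 2)"
      unfolding S_def using sub[OF K(1)] sub[OF K(2)] by (intro prob_gnp_superset[OF p] Un_least)
    then show "measure_pmf.prob (gnp n p) (S K K') = p ^ (12 - (card (K \<inter> K') choose 2))"
      unfolding card_nsets_2_Un[OF K] .
  qed
  finally have "measure_pmf.variance (gnp n p) ?X
      = (\<Sum>K\<in>?V. \<Sum>K'\<in>?V. p ^ (12 - (card (K \<inter> K') choose 2))) - (real (n choose 4) * p ^ 6)\<^sup>2"
    by (subst measure_pmf.variance_eq[OF int int]) (simp add: expectation_clique_count[OF p])
  also have "\<dots> = (\<Sum>K\<in>?V. \<Sum>K'\<in>?V. p ^ (12 - (card (K \<inter> K') choose 2)) - p ^ 12)"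
    by (simp add: sum_subtractf power_mult_distrib power2_eq_square flip: power_add)
  also have "\<dots> \<le> (\<Sum>K\<in>?V. 6 * real n ^ 2 * p ^ 11 + 4 * real n * p ^ 9 + p ^ 6)"
  proof (rule sum_mono)
    fix K assume K: "K \<in> ?V"
    define g where "g j = (if j < 2 then 0 else p ^ (12 - (j choose 2)))" for j
    have finV: "finite ?V" by (simp add: finite_imp_finite_nsets)
    have le4: "card (K \<inter> K') \<le> 4" for K' using K card_mono[of K "K \<inter> K'"] by (auto simp: nsets_def)
    have "(\<Sum>K'\<in>?V. p ^ (12 - (card (K \<inter> K') choose 2)) - p ^ 12) \<le> (\<Sum>K'\<in>?V. g (card (K \<inter> K')))"
      using p by (intro sum_mono) (auto simp: g_def binomial_eq_0)
    also have "\<dots> = (\<Sum>j\<in>{..4}. \<Sum>K'\<in>{K' \<in> ?V. card (K \<inter> K') = j}. g (card (K \<inter> K')))"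
      by (intro sum.group[symmetric]) (use finV le4 in auto)
    also have "\<dots> = (\<Sum>j\<in>{..4}. real (card {K' \<in> ?V. card (K \<inter> K') = j}) * g j)"
      by (intro sum.cong) auto
    also have "\<dots> \<le> (\<Sum>j\<in>{..4}. real ((4 choose j) * (n choose (4 - j))) * g j)"
      using p by (intro sum_mono mult_right_mono of_nat_mono card_nsets_inter_le[OF K]) (auto simp: g_def)
    also have "\<dots> = 6 * real (n choose 2) * p ^ 11 + 4 * real n * p ^ 9 + p ^ 6"
      by (simp add: g_def eval_nat_numeral)
    also have "\<dots> \<le> 6 * real n ^ 2 * p ^ 11 + 4 * real n * p ^ 9 + p ^ 6"
    proof -
      have "n choose 2 \<le> n ^ 2" by (cases "2 \<le> n") (auto intro: binomial_le_pow simp: binomial_eq_0 not_le)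
      then have "real (n choose 2) \<le> real n ^ 2" by (metis of_nat_mono of_nat_power)
      then show ?thesis using p by (simp add: mult_right_mono)
    qed
    finally show "(\<Sum>K'\<in>?V. p ^ (12 - (card (K \<inter> K') choose 2)) - p ^ 12)
      \<le> 6 * real n ^ 2 * p ^ 11 + 4 * real n * p ^ 9 + p ^ 6" .
  qed
  finally show ?thesis by simp
qed

text \<open>Chebyshev's inequality: the mean is at least \<open>r ^ 6 / 256\<close>, so fewer than
  \<open>r ^ 6 / 1000\<close> cliques means a deviation of at least \<open>r ^ 6 / 500\<close>. The
  variance is at most \<open>11 * r ^ 7\<close>, and \<open>11 * 500 ^ 2 = 2750000\<close>.\<close>

lemma prob_gnp_few_cliques:
  assumes r: "1 \<le> r" "real n = r ^ 3" and n: "4 \<le> n"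
  shows "measure_pmf.prob (gnp n (1 / r)) {E. real (card (four_cliques n E)) < r ^ 6 / 1000} \<le> 2750000 / r ^ 5"
proof -
  let ?X = "\<lambda>E. real (card (four_cliques n E))"
  define \<mu> where "\<mu> = real (n choose 4) * (1 / r) ^ 6"
  have p: "0 \<le> 1 / r" "1 / r \<le> 1" using r by auto
  have "(real n / 4) ^ 4 \<le> real (n choose 4)"
    using binomial_ge_n_over_k_pow_k[OF n, where 'a = real] by simp
  then have "(real n / 4) ^ 4 * (1 / r) ^ 6 \<le> \<mu>" unfolding \<mu>_def using r by (intro mult_right_mono) auto
  moreover have "(real n / 4) ^ 4 * (1 / r) ^ 6 = r ^ 6 / 256"
    unfolding r(2) using r(1) by (simp add: power_divide field_simps flip: power_mult power_add)
  ultimately have \<mu>: "r ^ 6 / 256 \<le> \<mu>" by simp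
  have pos: "0 < r ^ 6" using r by simp
  have "measure_pmf.prob (gnp n (1 / r)) {E. ?X E < r ^ 6 / 1000}
      \<le> measure_pmf.prob (gnp n (1 / r)) {E \<in> space (measure_pmf (gnp n (1 / r))). \<bar>?X E - measure_pmf.expectation (gnp n (1 / r)) ?X\<bar> \<ge> r ^ 6 / 500}"
    unfolding expectation_clique_count[OF p] \<mu>_def[symmetric]
    using \<mu> pos by (intro measure_pmf.finite_measure_mono) auto
  also have "\<dots> \<le> measure_pmf.variance (gnp n (1 / r)) ?X / (r ^ 6 / 500)\<^sup>2"
    using pos by (intro measure_pmf.Chebyshev_inequality integrable_measure_pmf_finite finite_set_pmf_gnp) auto
  also have "\<dots> \<le> (11 * r ^ 7) / (r ^ 6 / 500)\<^sup>2"
  proof (rule divide_right_mono)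
    have "n choose 4 \<le> n ^ 4" using n by (intro binomial_le_pow)
    then have c: "real (n choose 4) \<le> real n ^ 4" by (metis of_nat_mono of_nat_power)
    have "measure_pmf.variance (gnp n (1 / r)) ?X
      \<le> real (n choose 4) * (6 * real n ^ 2 * (1 / r) ^ 11 + 4 * real n * (1 / r) ^ 9 + (1 / r) ^ 6)"
      by (rule variance_clique_count[OF p])
    also have "\<dots> \<le> real n ^ 4 * (6 * real n ^ 2 * (1 / r) ^ 11 + 4 * real n * (1 / r) ^ 9 + (1 / r) ^ 6)"
      using c r by (intro mult_right_mono) auto
    also have "\<dots> = 6 * r ^ 7 + 5 * r ^ 6"
      unfolding r(2) using r(1) by (simp add: power_divide field_simps flip: power_mult power_add)
    also have "\<dots> \<le> 11 * r ^ 7" using r(1) power_increasing[of 6 7 r] by simp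
    finally show "measure_pmf.variance (gnp n (1 / r)) ?X \<le> 11 * r ^ 7" .
  qed auto
  also have "\<dots> = 2750000 / r ^ 5"
    using r(1) by (simp add: power_divide field_simps flip: power_mult power_add)
  finally show ?thesis .
qed

section \<open>Union bound over the sparsity conditions and passage to the limit\<close>

lemma sum_power_card_Pow:
  fixes y :: real
  assumes "finite V"
  shows "(\<Sum>A\<in>Pow V. y ^ card A) = (1 + y) ^ card V"
  using prod_add[OF assms, of "\<lambda>_. y" "\<lambda>_. 1"] by (simp add: add.commute)

text \<open>The three terms account for too few cliques, for a large codegree of some set of at most
  three vertices, and for too many edges between some pair of vertex sets.\<close>

lemma prob_gnp_not_sparse:
  assumes r: "1 \<le> r" "real n = r ^ 3" and n: "4 \<le> n" and L: "6 \<le> L"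
  shows "measure_pmf.prob (gnp n (1 / r)) {E. \<not> (sparse_graph n E r L \<and> r ^ 6 / 1000 \<le> real (card (four_cliques n E)))}
    \<le> 2750000 / r ^ 5 + 3 * real n ^ 3 * exp (3 - L) + (exp (real n * exp (- L / 2)) - 1)\<^sup>2"
proof -
  let ?P = "measure_pmf.prob (gnp n (1 / r))" and ?G = "nsets {..<n} 2"
  define bad where "bad = {E. \<not> (sparse_graph n E r L \<and> r ^ 6 / 1000 \<le> real (card (four_cliques n E)))}"
  define few where "few = {E. real (card (four_cliques n E)) < r ^ 6 / 1000}"
  define many where "many S = {E. E \<subseteq> ?G \<and> L * r ^ (3 - card S) < real (card (common_nbrs n E S))}" for S
  define dense where "dense q = (case q of (A, B) \<Rightarrow> {E. E \<subseteq> ?G \<and>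
    2 * (L / 2 * (real (card A) + real (card B) + real (card A) * real (card B) / r)) < real (card (edge_pairs E A B))})" for q
  define K where "K = {1, 2, 3 :: nat}"
  \<comment> \<open>Empty sets span no pairs. Leaving them out removes the term 1 from the sum over
    subsets, without which the bound would not tend to 0.\<close>
  define Q where "Q = Pow {..<n} - {{}}"
  define y where "y = exp (- L / 2)"
  have p: "0 \<le> 1 / r" "1 / r \<le> 1" using r by auto
  have finQ: "finite Q" by (simp add: Q_def)
  \<comment> \<open>Restricting to the support ensures \<open>E \<subseteq> ?G\<close>, which the
    sparsity conditions demand.\<close>
  have "?P bad = ?P (bad \<inter> set_pmf (gnp n (1 / r)))" by (simp add: measure_Int_set_pmf)
  also have "\<dots> \<le> ?P (few \<union> (\<Union>k\<in>K. \<Union>S\<in>nsets {..<n} k. many S) \<union> (\<Union>q\<in>Q \<times> Q. dense q))"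
  proof (rule measure_pmf.finite_measure_mono)
    show "bad \<inter> set_pmf (gnp n (1 / r)) \<subseteq> few \<union> (\<Union>k\<in>K. \<Union>S\<in>nsets {..<n} k. many S) \<union> (\<Union>q\<in>Q \<times> Q. dense q)"
    proof (rule subsetI, rule ccontr)
      fix E assume E: "E \<in> bad \<inter> set_pmf (gnp n (1 / r))"
        and not: "E \<notin> few \<union> (\<Union>k\<in>K. \<Union>S\<in>nsets {..<n} k. many S) \<union> (\<Union>q\<in>Q \<times> Q. dense q)"
      have EG: "E \<subseteq> ?G" using E set_pmf_gnp by blast
      have "sparse_graph n E r L"
      proof
        fix S assume S: "S \<subseteq> {..<n}" "1 \<le> card S" "card S \<le> 3"
        then have "S \<in> nsets {..<n} (card S)" "card S \<in> K"
          by (auto simp: nsets_def K_def finite_subset)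
        then have "E \<notin> many S" using not by blast
        then show "real (card (common_nbrs n E S)) \<le> L * r ^ (3 - card S)"
          using EG by (auto simp: many_def)
      next
        fix A B assume AB: "A \<subseteq> {..<n}" "B \<subseteq> {..<n}"
        show "real (card (edge_pairs E A B)) \<le> L * (real (card A) + real (card B) + real (card A) * real (card B) / r)"
        proof (cases "A = {} \<or> B = {}")
          case True
          then have "edge_pairs E A B = {}" by (auto simp: edge_pairs_def)
          then have "card (edge_pairs E A B) = 0" by (simp only: card.empty)
          then show ?thesis using L r by simp
        next
          case False
          then have "(A, B) \<in> Q \<times> Q" using AB by (simp add: Q_def)
          then have "E \<notin> dense (A, B)" using not by blast
          then show ?thesis using EG by (auto simp: dense_def)
        qed
      qed (use r L EG in auto)
      moreover have "r ^ 6 / 1000 \<le> real (card (four_cliques n E))" using not by (simp add: few_def)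
      ultimately show False using E by (simp add: bad_def)
    qed
  qed auto
  also have "\<dots> \<le> ?P few + ?P (\<Union>k\<in>K. \<Union>S\<in>nsets {..<n} k. many S) + ?P (\<Union>q\<in>Q \<times> Q. dense q)"
    by (intro order_trans[OF measure_Un_le] add_right_mono measure_Un_le) auto
  also have "\<dots> \<le> 2750000 / r ^ 5 + 3 * real n ^ 3 * exp (3 - L) + (exp (real n * exp (- L / 2)) - 1)\<^sup>2"
  proof (intro add_mono)
    show "?P few \<le> 2750000 / r ^ 5" unfolding few_def by (rule prob_gnp_few_cliques[OF r n])
  next
    have many: "?P (many S) \<le> exp (3 - L)" if "S \<in> nsets {..<n} k" "k \<in> K" for S k
    proof -
      have S: "S \<subseteq> {..<n}" "card S = k" using that by (auto simp: nsets_def)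
      have k: "k \<le> 3" using that by (auto simp: K_def)
      have "?P (many S) \<le> exp (3 * (real n * (1 / r) ^ card S) - L * r ^ (3 - card S))"
        unfolding many_def by (rule prob_gnp_common_nbrs[OF p S(1)])
      also have "real n * (1 / r) ^ card S = r ^ (3 - card S)"
        using r k S by (simp add: power_divide power_diff)
      also have "3 * r ^ (3 - card S) - L * r ^ (3 - card S) = (3 - L) * r ^ (3 - card S)"
        by (simp add: algebra_simps)
      \<comment> \<open>The factor \<open>3 - L\<close> is negative, so the weakest case is
        \<open>r ^ 0\<close>.\<close>
      also have "\<dots> \<le> (3 - L) * 1"
        using r L by (intro mult_left_mono_neg) auto
      finally show ?thesis by simp
    qed
    have "?P (\<Union>k\<in>K. \<Union>S\<in>nsets {..<n} k. many S) \<le> (\<Sum>k\<in>K. ?P (\<Union>S\<in>nsets {..<n} k. many S))"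
      by (intro measure_pmf.finite_measure_subadditive_finite) (auto simp: K_def)
    also have "\<dots> \<le> (\<Sum>k\<in>K. \<Sum>S\<in>nsets {..<n} k. ?P (many S))"
      by (intro sum_mono measure_pmf.finite_measure_subadditive_finite) (auto intro: finite_imp_finite_nsets)
    also have "\<dots> \<le> (\<Sum>k\<in>K. \<Sum>S\<in>nsets {..<n} k. exp (3 - L))"
      by (intro sum_mono many)
    also have "\<dots> = (\<Sum>k\<in>K. real (n choose k) * exp (3 - L))" by simp
    also have "\<dots> \<le> (\<Sum>k\<in>K. real n ^ 3 * exp (3 - L))"
    proof (intro sum_mono mult_right_mono)
      fix k assume k: "k \<in> K"
      then have "n choose k \<le> n ^ k" using n by (intro binomial_le_pow) (auto simp: K_def)
      also have "\<dots> \<le> n ^ 3" using k n by (intro power_increasing) (auto simp: K_def)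
      finally show "real (n choose k) \<le> real n ^ 3" by (metis of_nat_mono of_nat_power)
    qed auto
    also have "\<dots> = 3 * real n ^ 3 * exp (3 - L)" by (simp add: K_def)
    finally show "?P (\<Union>k\<in>K. \<Union>S\<in>nsets {..<n} k. many S) \<le> 3 * real n ^ 3 * exp (3 - L)" .
  next
    have dense: "?P (dense (A, B)) \<le> y ^ card A * y ^ card B" if "A \<in> Q" "B \<in> Q" for A B
    proof -
      let ?a = "real (card A)" and ?b = "real (card B)"
      have fin: "finite A" "finite B" using that by (auto simp: Q_def intro: finite_subset)
      have "?P (dense (A, B)) \<le> exp (3 * (?a * ?b * (1 / r)) - L / 2 * (?a + ?b + ?a * ?b / r))"
        unfolding dense_def prod.case by (rule prob_gnp_edge_pairs[OF p fin])
      also have "\<dots> \<le> exp (- L / 2 * (?a + ?b))"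
      proof -
        \<comment> \<open>By \<open>6 \<le> L\<close> the mean is absorbed by the product term of
          the threshold. The linear terms remain and make the sum over \<open>A\<close> and
          \<open>B\<close> factor.\<close>
        have "3 * (?a * ?b / r) \<le> L / 2 * (?a * ?b / r)" using L r by (intro mult_right_mono) auto
        then show ?thesis by (simp add: algebra_simps)
      qed
      also have "\<dots> = y ^ card A * y ^ card B"
        unfolding y_def by (simp add: exp_of_nat_mult[symmetric] exp_add[symmetric] algebra_simps)
      finally show ?thesis .
    qed
    have "(\<Sum>A\<in>Q. y ^ card A) = (1 + y) ^ n - 1"
      unfolding Q_def by (subst sum_diff1) (simp_all add: sum_power_card_Pow)
    also have "\<dots> \<le> exp (real n * y) - 1"
      using power_mono[of "1 + y" "exp y" n] by (simp add: exp_of_nat_mult y_def)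
    finally have sum_le: "(\<Sum>A\<in>Q. y ^ card A) \<le> exp (real n * y) - 1" .
    have "?P (\<Union>q\<in>Q \<times> Q. dense q) \<le> (\<Sum>q\<in>Q \<times> Q. ?P (dense q))"
      using finQ by (intro measure_pmf.finite_measure_subadditive_finite) auto
    also have "\<dots> \<le> (\<Sum>(A, B)\<in>Q \<times> Q. y ^ card A * y ^ card B)"
      using dense by (intro sum_mono) auto
    also have "\<dots> = (\<Sum>A\<in>Q. y ^ card A)\<^sup>2"
      by (simp add: power2_eq_square sum_product sum.cartesian_product)
    also have "\<dots> \<le> (exp (real n * y) - 1)\<^sup>2"
      by (intro power_mono sum_le sum_nonneg) (simp add: y_def)
    finally show "?P (\<Union>q\<in>Q \<times> Q. dense q) \<le> (exp (real n * exp (- L / 2)) - 1)\<^sup>2"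
      unfolding y_def .
  qed
  finally show ?thesis unfolding bad_def .
qed

text \<open>Every loss is a power of \<open>Q = q * ln n\<close>: \<open>Q ^ (6 * m)\<close> for the
  factorials, \<open>Q ^ (9 * m)\<close> for the row count and \<open>Q ^ (12 * m)\<close> for the
  norm of \<open>f^m\<close>. Together this is \<open>27 * m \<le> 8 * q\<close>. The assumption
  \<open>5000 \<le> l\<close> trades numerical constants for one more logarithm.\<close>

lemma ratio_bound_polylog:
  fixes n m A :: nat and r :: real
  defines "l \<equiv> ln (real n)" and "q \<equiv> 4 * m"
  assumes n: "n > 0" and l: "5000 \<le> l" and r: "r = real n powr (1 / 3)" and A: "real A + 1 \<le> 2 * l"
  shows "real n powr (real q / 24) / (real q * l) ^ (8 * q)
    \<le> sqrt ((r / (5000 * (l\<^sup>2) ^ 4)) ^ m / (fact (2 * m) * fact (4 * m))) / (160 * (l\<^sup>2) ^ 4 * (real A + 1) ^ 3) ^ m"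
\<comment> \<open>Both sides equal 1, as \<open>0 ^ 0 = 1\<close>.\<close>
proof (cases "m = 0")
  case True
  then show ?thesis using n by (simp add: q_def)
next
  case False
  define Q where "Q = real q * l"
  have r0: "0 < r" using n r by simp
  have Q: "l \<le> Q" "real q \<le> Q" "1 \<le> Q"
  proof -
    have "1 \<le> real q" using False by (simp add: q_def)
    then show "l \<le> Q" "real q \<le> Q"
      unfolding Q_def using l mult_mono[of 1 "real q" l l] mult_mono[of "real q" "real q" 1 l] by auto
    then show "1 \<le> Q" using l by linarith
  qed
  have facts: "fact (2 * m) * fact (4 * m) \<le> Q ^ (6 * m)"
  proof -
    have "fact j \<le> Q ^ j" if "j \<le> q" for j
    proof -
      have "fact j \<le> real j ^ j" using fact_le_power[of j, where 'a = real] by simp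
      also have "\<dots> \<le> Q ^ j" using that Q(2) by (intro power_mono) auto
      finally show ?thesis .
    qed
    then have "fact (2 * m) * fact (4 * m) \<le> Q ^ (2 * m) * Q ^ (4 * m)"
      using Q by (intro mult_mono) (auto simp: q_def)
    then show ?thesis by (simp flip: power_add)
  qed
  have "5000 * (l\<^sup>2) ^ 4 \<le> l * l ^ 8" using l by (simp flip: power_mult)
  also have "\<dots> = l ^ 9" by (simp add: eval_nat_numeral)
  also have "\<dots> \<le> Q ^ 9" using Q l by (intro power_mono) auto
  finally have c: "5000 * (l\<^sup>2) ^ 4 \<le> Q ^ 9" .
  have "160 * (l\<^sup>2) ^ 4 * (real A + 1) ^ 3 \<le> 160 * (l\<^sup>2) ^ 4 * (2 * l) ^ 3"
    using A by (intro mult_left_mono power_mono) auto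
  also have "\<dots> = 1280 * l ^ 11" by (simp add: eval_nat_numeral)
  also have "\<dots> \<le> l * l ^ 11" using l by (intro mult_right_mono) auto
  also have "\<dots> = l ^ 12" by (simp add: eval_nat_numeral)
  also have "\<dots> \<le> Q ^ 12" using Q l by (intro power_mono) auto
  finally have B: "160 * (l\<^sup>2) ^ 4 * (real A + 1) ^ 3 \<le> Q ^ 12" .
  have B0: "0 < 160 * (l\<^sup>2) ^ 4 * (real A + 1) ^ 3" using l by (intro mult_pos_pos) auto
  have "r ^ m / Q ^ (15 * m) = (r / Q ^ 9) ^ m / Q ^ (6 * m)"
    using Q by (simp add: power_divide flip: power_mult power_add)
  also have "\<dots> \<le> (r / (5000 * (l\<^sup>2) ^ 4)) ^ m / (fact (2 * m) * fact (4 * m))"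
  proof (rule frac_le)
    show "(r / Q ^ 9) ^ m \<le> (r / (5000 * (l\<^sup>2) ^ 4)) ^ m"
      using c r0 l Q by (intro power_mono divide_left_mono mult_pos_pos) auto
  qed (use facts r0 l in auto)
  finally have s1: "sqrt (r ^ m / Q ^ (15 * m)) \<le> sqrt ((r / (5000 * (l\<^sup>2) ^ 4)) ^ m / (fact (2 * m) * fact (4 * m)))"
    by (rule real_sqrt_le_mono)
  \<comment> \<open>The root in the denominator is given up, which affects only the constant in the
    exponent.\<close>
  have s2: "sqrt (r ^ m) / Q ^ (15 * m) \<le> sqrt (r ^ m / Q ^ (15 * m))"
  proof -
    have "1 \<le> Q ^ (15 * m)" using Q by simp
    then have "sqrt (Q ^ (15 * m)) \<le> Q ^ (15 * m)" by (simp add: real_le_lsqrt power2_eq_square)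
    then show ?thesis using r0 Q unfolding real_sqrt_divide by (intro divide_left_mono mult_pos_pos) auto
  qed
  \<comment> \<open>Here \<open>r ^ (m / 2) = n ^ (m / 6)\<close> and
    \<open>q = 4 * m\<close>.\<close>
  have s3: "sqrt (r ^ m) = real n powr (real q / 24)"
  proof -
    have "r ^ m = real n powr (real m / 3)"
      using r0 n unfolding r by (simp add: powr_powr flip: powr_realpow)
    then show ?thesis using n by (simp add: powr_powr q_def flip: powr_half_sqrt)
  qed
  have s4: "real n powr (real q / 24) / Q ^ (15 * m)
      \<le> sqrt ((r / (5000 * (l\<^sup>2) ^ 4)) ^ m / (fact (2 * m) * fact (4 * m)))"
    using order_trans[OF s2 s1] unfolding s3 .
  have "real n powr (real q / 24) / Q ^ (15 * m) / Q ^ (12 * m)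
      \<le> sqrt ((r / (5000 * (l\<^sup>2) ^ 4)) ^ m / (fact (2 * m) * fact (4 * m))) / (160 * (l\<^sup>2) ^ 4 * (real A + 1) ^ 3) ^ m"
  proof (rule frac_le)
    show "(160 * (l\<^sup>2) ^ 4 * (real A + 1) ^ 3) ^ m \<le> Q ^ (12 * m)"
      unfolding power_mult using B B0 by (intro power_mono) auto
  qed (use s4 B0 r0 l in auto)
  moreover have "real n powr (real q / 24) / Q ^ (8 * q) \<le> real n powr (real q / 24) / Q ^ (15 * m) / Q ^ (12 * m)"
  proof -
    have "Q ^ (15 * m + 12 * m) \<le> Q ^ (8 * q)" using Q by (intro power_increasing) (auto simp: q_def)
    then show ?thesis
      using Q unfolding divide_divide_eq_left power_add[symmetric] by (intro divide_left_mono) auto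
  qed
  ultimately show ?thesis unfolding Q_def by linarith
qed

text \<open>The failure probability \<open>\<delta> n\<close> does not involve \<open>q\<close>,
  because \<open>sparse_graph\<close> yields the ratio for all exponents at once; so
  \<open>q\<close> may vary with \<open>n\<close>. The choice \<open>L = (ln n)\<^sup>2\<close>
  makes \<open>exp (- L)\<close> and \<open>exp (- L / 2)\<close> smaller than any inverse power of
  \<open>n\<close>.\<close>

lemma prob_ratio_tendsto_1:
  assumes q: "\<forall>n. 4 dvd q n"
  shows "(\<lambda>n. measure_pmf.prob (gnp n (real n powr (- 1 / 3)))
        {E. sp_norm n (q n) (\<lambda>x. clique_poly n E x ^ (q n div 4)) /
              two_norm n (\<lambda>x. clique_poly n E x ^ (q n div 4))
            \<ge> real n powr (real (q n) / 24) / (real (q n) * ln (real n)) ^ (8 * q n)})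
     \<longlonglongrightarrow> 1"
proof -
  let ?P = "\<lambda>n. measure_pmf.prob (gnp n (real n powr (- 1 / 3)))"
  define good where "good n = {E. sp_norm n (q n) (\<lambda>x. clique_poly n E x ^ (q n div 4)) /
              two_norm n (\<lambda>x. clique_poly n E x ^ (q n div 4))
            \<ge> real n powr (real (q n) / 24) / (real (q n) * ln (real n)) ^ (8 * q n)}" for n
  define \<delta> where "\<delta> n = 2750000 / (real n powr (1 / 3)) ^ 5 + 3 * real n ^ 3 * exp (3 - (ln (real n))\<^sup>2)
      + (exp (real n * exp (- (ln (real n))\<^sup>2 / 2)) - 1)\<^sup>2" for n :: nat
  have \<delta>: "\<delta> \<longlonglongrightarrow> 0" unfolding \<delta>_def by real_asymp
  have lower: "eventually (\<lambda>n. 1 - \<delta> n \<le> ?P n (good n)) sequentially"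
  proof -
    have "eventually (\<lambda>n. 5000 \<le> ln (real n)) sequentially" "eventually (\<lambda>n::nat. 4 \<le> n) sequentially"
      by real_asymp+
    then show ?thesis
    proof eventually_elim
      case (elim n)
      define r where "r = real n powr (1 / 3)"
      define l where "l = ln (real n)"
      \<comment> \<open>About \<open>ln n\<close> dyadic levels suffice, since
        \<open>n = exp l \<le> 4 ^ A\<close>.\<close>
      define A where "A = nat \<lceil>l\<rceil>"
      define m where "m = q n div 4"
      have qm: "q n = 4 * m" using q by (simp add: m_def)
      have r: "1 \<le> r" "real n = r ^ 3"
        using elim unfolding r_def by (simp_all add: ge_one_powr_ge_zero powr_power)
      have p: "real n powr (- 1 / 3) = 1 / r" by (simp add: r_def powr_minus_divide)
      have "6 \<le> (5000 :: real)\<^sup>2" by simp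
      also have "5000\<^sup>2 \<le> l\<^sup>2" using elim unfolding l_def by (intro power_mono) auto
      finally have L: "6 \<le> l\<^sup>2" .
      have A: "l \<le> real A" "real A + 1 \<le> 2 * l" using elim unfolding A_def l_def by linarith+
      have "real n = exp l" using elim by (simp add: l_def)
      also have "\<dots> \<le> exp 1 ^ A" using A(1) by (simp flip: exp_of_nat_mult)
      also have "\<dots> \<le> 4 ^ A" using exp_le by (intro power_mono) auto
      also have "\<dots> \<le> real (4 ^ (A + 1))" by simp
      finally have nA: "n \<le> 4 ^ (A + 1)" unfolding of_nat_le_iff .
      have "E \<in> good n" if "sparse_graph n E r (l\<^sup>2)" "r ^ 6 / 1000 \<le> real (card (four_cliques n E))" for E
      proof -
        have "real n powr (real (q n) / 24) / (real (q n) * l) ^ (8 * q n)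
          \<le> sqrt ((r / (5000 * (l\<^sup>2) ^ 4)) ^ m / (fact (2 * m) * fact (4 * m))) / (160 * (l\<^sup>2) ^ 4 * (real A + 1) ^ 3) ^ m"
          unfolding qm l_def using elim A(2) by (intro ratio_bound_polylog) (auto simp: l_def r_def)
        also have "\<dots> \<le> sp_norm n (4 * m) (\<lambda>x. clique_poly n E x ^ m) / two_norm n (\<lambda>x. clique_poly n E x ^ m)"
          by (rule sparse_graph.ratio_ge[OF that(1) nA that(2)])
        finally show ?thesis unfolding good_def by (simp add: qm l_def)
      qed
      then have "- good n \<subseteq> {E. \<not> (sparse_graph n E r (l\<^sup>2) \<and> r ^ 6 / 1000 \<le> real (card (four_cliques n E)))}"
        by blast
      then have "?P n (- good n) \<le> ?P n {E. \<not> (sparse_graph n E r (l\<^sup>2) \<and> r ^ 6 / 1000 \<le> real (card (four_cliques n E)))}"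
        by (intro measure_pmf.finite_measure_mono) auto
      also have "\<dots> \<le> \<delta> n"
        using prob_gnp_not_sparse[OF r elim(2) L] unfolding p \<delta>_def r_def[symmetric] l_def[symmetric] .
      finally have "?P n (- good n) \<le> \<delta> n" .
      moreover have "?P n (- good n) = 1 - ?P n (good n)"
        using measure_pmf.prob_compl[of "good n"] by (simp add: Compl_eq_Diff_UNIV)
      ultimately show ?case by linarith
    qed
  qed
  have lim: "(\<lambda>n. 1 - \<delta> n) \<longlonglongrightarrow> 1" using tendsto_diff[OF tendsto_const \<delta>, of 1] by simp
  have upper: "eventually (\<lambda>n. ?P n (good n) \<le> 1) sequentially" by simp
  have "(\<lambda>n. ?P n (good n)) \<longlonglongrightarrow> 1"
    by (rule tendsto_sandwich[OF lower upper lim tendsto_const])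
  then show ?thesis unfolding good_def .
qed

text \<open>\<open>C\<close> is chosen before \<open>q\<close>, so the constant hidden in
  \<open>O(q)\<close> is absolute. Taking \<open>q\<close> as a sequence lets it grow with
  \<open>n\<close>; constant sequences give the case of fixed \<open>q\<close>.\<close>

theorem theorem8p3:
  "\<exists>C::nat. \<forall>q :: nat \<Rightarrow> nat. (\<forall>n. 4 dvd q n) \<longrightarrow>
     (\<lambda>n. measure_pmf.prob (gnp n (real n powr (- 1 / 3)))
        {E. sp_norm n (q n) (\<lambda>x. clique_poly n E x ^ (q n div 4)) /
              two_norm n (\<lambda>x. clique_poly n E x ^ (q n div 4))
            \<ge> real n powr (real (q n) / 24) / (real (q n) * ln (real n)) ^ (C * q n)})
     \<longlonglongrightarrow> 1"
  by (intro exI[of _ 8] allI impI prob_ratio_tendsto_1) simp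

end
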